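(* Let $b\in\mathscr{S}(n)$ and $\alpha\in\mathcal{U}(n)$. If $\lambda\in\mathbb{T}$ is such that $\boldsymbol{\mu}^\alpha\{\lambda\}\neq0$, and $E=\operatorname{Ran}\boldsymbol{\mu}^\alpha\{\lambda\}$, then $b\alpha^*$ has a Carathéodory angular derivative $\operatorname{CAD}_E(b\alpha^* )(\lambda)$ at $\lambda$ on the subspace $E$, and its Moore--Penrose inverse equals $\lambda\,\boldsymbol{\mu}^\alpha\{\lambda\}$.
   Context: $\mathbb{D}$ is the open unit disc and $\mathbb{T}=\partial\mathbb{D}$. $\mathscr{S}(n)$ is the set of bounded analytic $n\times n$ matrix-valued functions $b$ on $\mathbb{D}$ with $\|b(z)\|<1$ (operator norm) for all $z\in\mathbb{D}$. $\mathcal{U}(n)$ is the group of unitary $n\times n$ matrices. For $b\in\mathscr{S}(n)$ and $\alpha\in\mathcal{U}(n)$, the Aleksandrov--Clark measure $\boldsymbol{\mu}^\alpha$ is the unique finite non-negative $\mathbb{C}^{n\times n}$-valued Borel measure on $\mathbb{T}$ such that, with $H_\alpha(z)=(I_n+b(z)\alpha^* )(I_n-b(z)\alpha^* )^{-1}$, $$H_\alpha(z)=i\,\mathrm{Im}\,H_\alpha(0)+\int_{\mathbb{T}}\frac{\zeta+z}{\zeta-z}\,\boldsymbol{\mu}^\alpha(\mathrm{d}\zeta),\qquad z\in\mathbb{D},$$ where $\mathrm{Im}\,A=(A-A^* )/(2i)$. We write $\boldsymbol{\mu}^\alpha\{\lambda\}=\boldsymbol{\mu}^\alpha(\{\lambda\})$.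 The non-tangential ("n.t.") limit $z\to\lambda$ means the limit from within every Stolz region $\Gamma_t(\lambda)=\{z\in\mathbb{D}:|z-\lambda|<t(1-|z|)\}$, $t>1$. For a subspace $E\subset\mathbb{C}^n$ with orthogonal projection $P_E$, a function $f\in\mathscr{S}(n)$ has a Carathéodory angular derivative (CAD) at $\lambda\in\mathbb{T}$ on $E$ if $\lim_{z\to\lambda\ \text{n.t.}}f(z)\mathbf{e}=\mathbf{e}$ for every $\mathbf{e}\in E$, and the limit $\operatorname{CAD}_E f(\lambda):=\lim_{z\to\lambda\ \text{n.t.}}P_E\,f'(z)\,P_E$ exists (as an $n\times n$ matrix). *)

theory Defs
  imports "HOL-Analysis.Analysis"
begin

section \<open>Complex matrices\<close>

definition cinner :: "complex ^ 'n \<Rightarrow> complex ^ 'n \<Rightarrow> complex" where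
  "cinner v w = (\<Sum>i\<in>UNIV. v $ i * cnj (w $ i))"

definition mat_adj :: "complex ^ 'n ^ 'm \<Rightarrow> complex ^ 'm ^ 'n" where
  "mat_adj A = (\<chi> i j. cnj (A $ j $ i))"

definition cscale :: "complex \<Rightarrow> complex ^ 'n ^ 'm \<Rightarrow> complex ^ 'n ^ 'm" where
  "cscale c A = (\<chi> i j. c * A $ i $ j)"

definition unitary_matrix :: "complex ^ 'n ^ 'n \<Rightarrow> bool" where
  "unitary_matrix U \<longleftrightarrow> mat_adj U ** U = mat 1 \<and> U ** mat_adj U = mat 1"

text \<open>Self-adjointness is implied, since \<open>v\<close> ranges over complex vectors.\<close>
definition nonneg_matrix :: "complex ^ 'n ^ 'n \<Rightarrow> bool" where
  "nonneg_matrix A \<longleftrightarrow> (\<forall>v. cinner (A *v v) v \<in> \<real>\<^sub>\<ge>\<^sub>0)"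

definition im_part :: "complex ^ 'n ^ 'n \<Rightarrow> complex ^ 'n ^ 'n" where
  "im_part A = cscale (1 / (2 * \<i>)) (A - mat_adj A)"

definition orth_proj :: "(complex ^ 'n) set \<Rightarrow> complex ^ 'n ^ 'n" where
  "orth_proj E = (THE P. P ** P = P \<and> mat_adj P = P \<and> range ((*v) P) = E)"

definition is_moore_penrose :: "complex ^ 'n ^ 'n \<Rightarrow> complex ^ 'n ^ 'n \<Rightarrow> bool" where
  "is_moore_penrose A X \<longleftrightarrow>
     A ** X ** A = A \<and> X ** A ** X = X \<and>
     mat_adj (A ** X) = A ** X \<and> mat_adj (X ** A) = X ** A"

definition moore_penrose_inverse :: "complex ^ 'n ^ 'n \<Rightarrow> complex ^ 'n ^ 'n" where
  "moore_penrose_inverse A = (THE X. is_moore_penrose A X)"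


section \<open>Matrix-valued analytic functions on the disc\<close>

definition matrix_holomorphic_on :: "(complex \<Rightarrow> complex ^ 'n ^ 'n) \<Rightarrow> complex set \<Rightarrow> bool" where
  "matrix_holomorphic_on f S \<longleftrightarrow> (\<forall>i j. (\<lambda>z. f z $ i $ j) holomorphic_on S)"

definition matrix_deriv :: "(complex \<Rightarrow> complex ^ 'n ^ 'n) \<Rightarrow> complex \<Rightarrow> complex ^ 'n ^ 'n" where
  "matrix_deriv f z = (\<chi> i j. deriv (\<lambda>w. f w $ i $ j) z)"

text \<open>The operator norm is \<open>onorm\<close> of the induced map; \<open>norm\<close> on the matrix type itself
  is the Frobenius norm.\<close>
definition schur_class :: "(complex \<Rightarrow> complex ^ 'n ^ 'n) set" where
  "schur_class = {b. matrix_holomorphic_on b (ball 0 1) \<and> (\<forall>z\<in>ball 0 1. onorm ((*v) (b z)) < 1)}"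

definition stolz :: "complex \<Rightarrow> real \<Rightarrow> complex set" where
  "stolz \<xi> t = {z \<in> ball 0 1. cmod (z - \<xi>) < t * (1 - cmod z)}"

definition nt_tendsto :: "(complex \<Rightarrow> 'a::topological_space) \<Rightarrow> 'a \<Rightarrow> complex \<Rightarrow> bool" where
  "nt_tendsto f L \<xi> \<longleftrightarrow> (\<forall>t>1. (f \<longlongrightarrow> L) (at \<xi> within stolz \<xi> t))"

definition nt_lim :: "(complex \<Rightarrow> 'a::topological_space) \<Rightarrow> complex \<Rightarrow> 'a" where
  "nt_lim f \<xi> = (THE L. nt_tendsto f L \<xi>)"

definition has_CAD_on :: "(complex ^ 'n) set \<Rightarrow> (complex \<Rightarrow> complex ^ 'n ^ 'n) \<Rightarrow> complex \<Rightarrow> bool" where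
  "has_CAD_on E f \<xi> \<longleftrightarrow>
     f \<in> schur_class \<and> vec.subspace E \<and> \<xi> \<in> sphere 0 1 \<and>
     (\<forall>e\<in>E. nt_tendsto (\<lambda>z. f z *v e) e \<xi>) \<and>
     (\<exists>D. nt_tendsto (\<lambda>z. orth_proj E ** matrix_deriv f z ** orth_proj E) D \<xi>)"

definition CAD :: "(complex ^ 'n) set \<Rightarrow> (complex \<Rightarrow> complex ^ 'n ^ 'n) \<Rightarrow> complex \<Rightarrow> complex ^ 'n ^ 'n" where
  "CAD E f \<xi> = nt_lim (\<lambda>z. orth_proj E ** matrix_deriv f z ** orth_proj E) \<xi>"


section \<open>Non-negative matrix-valued measures on the circle\<close>

abbreviation circle_borel :: "complex measure" where
  "circle_borel \<equiv> restrict_space borel (sphere 0 1)"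

text \<open>Finiteness is automatic, as all values are matrices. Values on non-Borel sets are
  irrelevant.\<close>
definition nonneg_matrix_measure :: "(complex set \<Rightarrow> complex ^ 'n ^ 'n) \<Rightarrow> bool" where
  "nonneg_matrix_measure \<mu> \<longleftrightarrow>
     \<mu> {} = 0 \<and>
     (\<forall>A\<in>sets circle_borel. nonneg_matrix (\<mu> A)) \<and>
     (\<forall>A. range A \<subseteq> sets circle_borel \<and> disjoint_family A \<longrightarrow>
            (\<lambda>k::nat. \<mu> (A k)) sums \<mu> (\<Union>k. A k))"

text \<open>The finite positive measure \<open>A \<mapsto> \<langle>\<mu>(A) v, v\<rangle>\<close>.\<close>
definition quad_measure :: "(complex set \<Rightarrow> complex ^ 'n ^ 'n) \<Rightarrow> complex ^ 'n \<Rightarrow> complex measure" where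
  "quad_measure \<mu> v =
     measure_of (sphere 0 1) (sets circle_borel) (\<lambda>A. ennreal (Re (cinner (\<mu> A *v v) v)))"

text \<open>The \<open>(i, j)\<close> entry is the integral of \<open>f\<close> against the complex measure
  \<open>A \<mapsto> \<mu>(A)\<^sub>i\<^sub>j = \<langle>\<mu>(A) e\<^sub>j, e\<^sub>i\<rangle>\<close>, which polarization writes as a combination of the four
  positive measures \<open>A \<mapsto> \<langle>\<mu>(A) v, v\<rangle>\<close> with \<open>v = e\<^sub>j + \<i>\<^sup>k e\<^sub>i\<close>.\<close>
definition matrix_integral ::
    "(complex set \<Rightarrow> complex ^ 'n ^ 'n) \<Rightarrow> (complex \<Rightarrow> complex) \<Rightarrow> complex ^ 'n ^ 'n" where
  "matrix_integral \<mu> f =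
     (\<chi> i j. (1 / 4) * (\<Sum>k<4. \<i> ^ k *
        integral\<^sup>L (quad_measure \<mu> (axis j 1 + axis i (\<i> ^ k))) f))"

lemma cinner_axis_polarization:
  fixes A :: "complex ^ 'n ^ 'n"
  shows "cinner (A *v (axis j 1 + axis i c)) (axis j 1 + axis i c) =
     A $ j $ j + c * A $ j $ i + cnj c * A $ i $ j + c * cnj c * A $ i $ i"
proof -
  have right: "cinner v (x + y) = cinner v x + cinner v y" for v x y :: "complex ^ 'n"
    by (simp add: cinner_def ring_distribs sum.distrib)
  have "cinner v (axis k d) = v $ k * cnj d" for v :: "complex ^ 'n" and k d
    by (simp add: cinner_def axis_def if_distrib cong: if_cong)
  moreover have "(A *v axis k d) $ l = A $ l $ k * d" for k l d
    by (simp add: matrix_vector_mult_def axis_def if_distrib cong: if_cong)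
  ultimately show ?thesis
    by (simp add: right matrix_vector_right_distrib algebra_simps)
qed

lemma polarization:
  fixes A :: "complex ^ 'n ^ 'n"
  shows "A $ i $ j = (1 / 4) * (\<Sum>k<4. \<i> ^ k *
     cinner (A *v (axis j 1 + axis i (\<i> ^ k))) (axis j 1 + axis i (\<i> ^ k)))"
  unfolding cinner_axis_polarization
  by (simp add: eval_nat_numeral lessThan_Suc algebra_simps)

lemma sums_cinner_quad:
  assumes "M sums (B :: complex ^ 'n ^ 'n)"
  shows "(\<lambda>k. cinner (M k *v v) v) sums cinner (B *v v) v"
proof -
  have "(\<lambda>k. M k $ i $ j) sums (B $ i $ j)" for i j
    by (intro bounded_linear.sums[OF bounded_linear_vec_nth] assms)
  then show ?thesis
    unfolding cinner_def matrix_vector_mult_def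
    by (auto intro!: sums_sum sums_mult sums_mult2)
qed

lemma emeasure_quad_measure:
  assumes \<mu>: "nonneg_matrix_measure \<mu>" and A: "A \<in> sets circle_borel"
  shows "emeasure (quad_measure \<mu> v) A = ennreal (Re (cinner (\<mu> A *v v) v))"
proof (rule emeasure_measure_of[OF quad_measure_def])
  have nonneg: "0 \<le> Re (cinner (\<mu> B *v v) v)" if "B \<in> sets circle_borel" for B
    using \<mu> that by (auto simp: nonneg_matrix_measure_def nonneg_matrix_def complex_nonneg_Reals_iff)
  have sp: "space circle_borel = sphere 0 1"
    by (simp add: space_restrict_space)
  have sig: "sets (quad_measure \<mu> v) = sets circle_borel"
    unfolding quad_measure_def using sets.sigma_sets_eq[of circle_borel]
    by (subst sets_measure_of) (use sets.space_closed[of circle_borel] sp in auto)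
  show "sets circle_borel \<subseteq> Pow (sphere 0 1)"
    using sets.space_closed[of circle_borel] sp by simp
  show "A \<in> sets (quad_measure \<mu> v)"
    using A sig by simp
  show "positive (sets (quad_measure \<mu> v)) (\<lambda>A. ennreal (Re (cinner (\<mu> A *v v) v)))"
    using \<mu> by (simp add: positive_def nonneg_matrix_measure_def cinner_def)
  show "countably_additive (sets (quad_measure \<mu> v)) (\<lambda>A. ennreal (Re (cinner (\<mu> A *v v) v)))"
    unfolding sig countably_additive_def
  proof (intro allI impI)
    fix B :: "nat \<Rightarrow> complex set"
    assume B: "range B \<subseteq> sets circle_borel" "disjoint_family B"
    then have "(\<lambda>k. \<mu> (B k)) sums \<mu> (\<Union>k. B k)"
      using \<mu> by (auto simp: nonneg_matrix_measure_def)
    from sums_Re[OF sums_cinner_quad[OF this]]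
    have "(\<lambda>k. Re (cinner (\<mu> (B k) *v v) v)) sums Re (cinner (\<mu> (\<Union>k. B k) *v v) v)" .
    then show "(\<Sum>k. ennreal (Re (cinner (\<mu> (B k) *v v) v))) =
        ennreal (Re (cinner (\<mu> (\<Union>k. B k) *v v) v))"
      using B nonneg by (subst suminf_ennreal_eq) auto
  qed
qed

lemma matrix_integral_indicator:
  assumes \<mu>: "nonneg_matrix_measure \<mu>" and A: "A \<in> sets circle_borel"
  shows "matrix_integral \<mu> (indicator A) = \<mu> A"
proof -
  have pos: "cinner (\<mu> A *v v) v \<in> \<real>\<^sub>\<ge>\<^sub>0" for v
    using \<mu> A by (auto simp: nonneg_matrix_measure_def nonneg_matrix_def)
  have sp: "A \<subseteq> space (quad_measure \<mu> v)" for v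
    using sets.sets_into_space[OF A] by (simp add: quad_measure_def space_measure_of_conv)
  have "integral\<^sup>L (quad_measure \<mu> v) (indicator A) = cinner (\<mu> A *v v) v" for v
  proof -
    have "integral\<^sup>L (quad_measure \<mu> v) (indicator A) =
        complex_of_real (measure (quad_measure \<mu> v) A)"
    proof -
      have "(\<lambda>x. indicator A x :: complex) = (\<lambda>x. complex_of_real (indicator A x))"
        by (auto simp: indicator_def)
      then show ?thesis
        using sp[of v] by (simp add: Int_absorb2)
    qed
    also have "\<dots> = complex_of_real (Re (cinner (\<mu> A *v v) v))"
      using pos[of v] by (simp add: measure_def emeasure_quad_measure[OF \<mu> A] complex_nonneg_Reals_iff)
    also have "\<dots> = cinner (\<mu> A *v v) v"
      using pos[of v] by (simp add: complex_nonneg_Reals_iff complex_eq_iff)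
    finally show ?thesis .
  qed
  then show ?thesis
    by (simp add: matrix_integral_def vec_eq_iff polarization[of "\<mu> A"])
qed


section \<open>Aleksandrov--Clark measures\<close>

definition AC_function ::
    "(complex \<Rightarrow> complex ^ 'n ^ 'n) \<Rightarrow> complex ^ 'n ^ 'n \<Rightarrow> complex \<Rightarrow> complex ^ 'n ^ 'n" where
  "AC_function b \<alpha> z =
     (mat 1 + b z ** mat_adj \<alpha>) ** matrix_inv (mat 1 - b z ** mat_adj \<alpha>)"

definition is_AC_measure ::
    "(complex \<Rightarrow> complex ^ 'n ^ 'n) \<Rightarrow> complex ^ 'n ^ 'n \<Rightarrow> (complex set \<Rightarrow> complex ^ 'n ^ 'n) \<Rightarrow> bool"
  where
  "is_AC_measure b \<alpha> \<mu> \<longleftrightarrow>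
     nonneg_matrix_measure \<mu> \<and>
     (\<forall>z\<in>ball 0 1.
        AC_function b \<alpha> z =
          cscale \<i> (im_part (AC_function b \<alpha> 0)) +
          matrix_integral \<mu> (\<lambda>\<zeta>. (\<zeta> + z) / (\<zeta> - z)))"

end

(* Put f = b \<alpha>*, J = I - f, M = \<mu>{\<xi>} and H = (I + f) J^-1, so that H + I = 2 J^-1. The real part of H + I is
   I plus the Poisson integral of \<mu>, which dominates p M, where p is the Poisson kernel at \<xi>; pairing
   (H + I) x = 2 M w with x = J M w therefore bounds |x|^2 by <M w, w> / p, which tends to 0
   non-tangentially. Hence f e tends to e on the range of M, and the same bound holds for J* M.
   Splitting H + I = c M + T, where c = (\<xi> + z) / (\<xi> - z) is the Herglotz kernel at \<xi>, gives
   c M J M = 2 M - M J T. Although T is only o(1 / |\<xi> - z|), M J T tends to 0, by the Cauchy-Schwarz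
   inequality for the matrix measure and the bound for J* M. So M J M / (\<xi> - z) tends to
   cnj \<xi> M; multiplying by the Moore-Penrose inverse X of M on both sides, (P - P f P) / (\<xi> - z) tends
   to cnj \<xi> X, where P = M X = X M is the projection onto the range of M, and Cauchy's inequality
   turns this into P f' P \<rightarrow> cnj \<xi> X. *)
theory Submission
  imports Defs "HOL-Complex_Analysis.Cauchy_Integral_Formula"
begin

section \<open>Hermitian matrices\<close>

text \<open>The obstacle is the term M J T. For y, the adjoint of J applied to M v, the bound on |y|
  is only of order |\<xi> - z| to the power 1/2, so multiplying it by T = o(1 / |\<xi> - z|) proves
  nothing. What saves the argument is that the real part of H + I contains more than the mass at
  \<xi>: the same pairing bounds |y|^2 plus the integral of the Poisson kernel off \<xi> against
  <d\<mu> y, y>. So y is small in exactly the form in which T is large, and the Cauchy-Schwarz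
  inequality with weight Poisson + 1 balances the two. The adjoint enters because <M J T w, v> = <T
  w, y>. Since M may be singular, everything is compressed by M on both sides, and its Moore-Penrose
  inverse restores the projection only at the end.\<close>

lemma cinner_add_left: "cinner (x + y) z = cinner x z + cinner y z"
  by (simp add: cinner_def ring_distribs sum.distrib)

lemma cinner_add_right: "cinner x (y + z) = cinner x y + cinner x z"
  by (simp add: cinner_def ring_distribs sum.distrib)

lemma cinner_diff_left: "cinner (x - y) z = cinner x z - cinner y z"
  by (simp add: cinner_def ring_distribs sum_subtractf)

lemma cinner_diff_right: "cinner x (y - z) = cinner x y - cinner x z"
  by (simp add: cinner_def ring_distribs sum_subtractf)

lemma cinner_scale_left: "cinner (c *s x) y = c * cinner x y"
  by (simp add: cinner_def sum_distrib_left mult_ac)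

lemma cinner_scale_right: "cinner x (c *s y) = cnj c * cinner x y"
  by (simp add: cinner_def sum_distrib_left mult_ac)

lemma cinner_commute: "cinner x y = cnj (cinner y x)"
  by (simp add: cinner_def mult_ac)

lemma cinner_zero_left [simp]: "cinner 0 y = 0"
  by (simp add: cinner_def)

lemma cinner_zero_right [simp]: "cinner y 0 = 0"
  by (simp add: cinner_def)

lemma cinner_self: "cinner x x = complex_of_real ((norm x)\<^sup>2)"
  by (simp add: cinner_def norm_vec_def L2_set_def sum_nonneg complex_norm_square[symmetric])


lemma cinner_mat_adj: "cinner (A *v x) y = cinner x (mat_adj A *v y)"
proof -
  have "cinner (A *v x) y = (\<Sum>i\<in>UNIV. \<Sum>j\<in>UNIV. A $ i $ j * x $ j * cnj (y $ i))"
    by (simp add: cinner_def matrix_vector_mult_def sum_distrib_right)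
  also have "\<dots> = (\<Sum>j\<in>UNIV. \<Sum>i\<in>UNIV. A $ i $ j * x $ j * cnj (y $ i))"
    by (rule sum.swap)
  also have "\<dots> = cinner x (mat_adj A *v y)"
    by (simp add: cinner_def matrix_vector_mult_def mat_adj_def sum_distrib_left mult_ac)
  finally show ?thesis .
qed

lemma mat_adj_mat_adj [simp]: "mat_adj (mat_adj A) = A"
  by (simp add: mat_adj_def vec_eq_iff)

lemma cinner_mat_adj': "cinner (mat_adj A *v x) y = cinner x (A *v y)"
  using cinner_mat_adj[of "mat_adj A"] by simp

lemma Re_cinner_mat_adj: "Re (cinner (mat_adj A *v x) x) = Re (cinner (A *v x) x)"
  using cinner_commute[of x "A *v x"] by (simp add: cinner_mat_adj')

lemma mat_adj_mult: "mat_adj (A ** B) = mat_adj B ** mat_adj A"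
  by (simp add: mat_adj_def vec_eq_iff matrix_matrix_mult_def mult_ac)

lemma mat_adj_cscale: "mat_adj (cscale c A) = cscale (cnj c) (mat_adj A)"
  by (simp add: mat_adj_def vec_eq_iff cscale_def)

lemma mat_adj_one [simp]: "mat_adj (mat 1) = mat 1"
  by (auto simp add: mat_adj_def vec_eq_iff mat_def)

lemma cscale_mult_left: "cscale c A ** B = cscale c (A ** B)"
  by (simp add: cscale_def vec_eq_iff matrix_matrix_mult_def sum_distrib_left mult_ac)

lemma cscale_mult_right: "A ** cscale c B = cscale c (A ** B)"
  by (simp add: cscale_def vec_eq_iff matrix_matrix_mult_def sum_distrib_left mult_ac)

lemma cscale_mult_vec: "cscale c A *v x = c *s (A *v x)"
  by (simp add: cscale_def vec_eq_iff matrix_vector_mult_def sum_distrib_left mult_ac)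

lemma cscale_cscale [simp]: "cscale c (cscale d A) = cscale (c * d) A"
  by (simp add: cscale_def vec_eq_iff mult_ac)

lemma cscale_one [simp]: "cscale 1 A = A"
  by (simp add: cscale_def vec_eq_iff)

lemma cinner_axis: "cinner (A *v axis j 1) (axis i 1) = A $ i $ j"
proof -
  have "cinner v (axis i 1) = v $ i" for v :: "complex ^ 'a"
    by (simp add: cinner_def axis_def if_distrib cong: if_cong)
  moreover have "(A *v axis j 1) $ i = A $ i $ j"
    by (simp add: matrix_vector_mult_def axis_def if_distrib cong: if_cong)
  ultimately show ?thesis by simp
qed

lemma matrix_matrix_mult_nth: "(A ** B) $ i $ j = (\<Sum>k\<in>UNIV. A $ i $ k * B $ k $ j)"
  by (simp add: matrix_matrix_mult_def)

lemma matrix_add_rdistrib: "((A :: complex ^ 'n ^ 'm) + B) ** C = A ** C + B ** C"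
  by (simp add: vec_eq_iff matrix_matrix_mult_nth ring_distribs sum.distrib)

lemma matrix_diff_rdistrib: "((A :: complex ^ 'n ^ 'm) - B) ** C = A ** C - B ** C"
  by (simp add: vec_eq_iff matrix_matrix_mult_nth ring_distribs sum_subtractf)

lemma matrix_diff_ldistrib: "A ** ((B :: complex ^ 'n ^ 'm) - C) = A ** B - A ** C"
  by (simp add: vec_eq_iff matrix_matrix_mult_nth ring_distribs sum_subtractf)

lemma cmod_cinner_le: "cmod (cinner x y) \<le> norm x * norm y"
proof -
  have "cmod (cinner x y) \<le> (\<Sum>i\<in>UNIV. norm (x $ i) * norm (y $ i))"
    unfolding cinner_def by (rule order_trans[OF norm_sum]) (simp add: norm_mult)
  also have "\<dots> \<le> norm x * norm y"
    unfolding norm_vec_def using L2_set_mult_ineq[of "\<lambda>i. norm (x $ i)" "\<lambda>i. norm (y $ i)" UNIV]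
    by simp
  finally show ?thesis .
qed

lemma bounded_linear_matrix_vector: "bounded_linear ((*v) (A :: complex ^ 'n ^ 'm))"
  unfolding linear_conv_bounded_linear[symmetric]
  by (rule linearI)
    (simp_all add: matrix_vector_mult_def vec_eq_iff ring_distribs sum.distrib scaleR_sum_right)

lemma cmod_cinner_matrix_le: "cmod (cinner (A *v x) y) \<le> onorm ((*v) A) * norm x * norm y"
proof -
  have "cmod (cinner (A *v x) y) \<le> norm (A *v x) * norm y"
    by (rule cmod_cinner_le)
  also have "\<dots> \<le> onorm ((*v) A) * norm x * norm y"
    by (intro mult_right_mono onorm bounded_linear_matrix_vector) auto
  finally show ?thesis .
qed

text \<open>\<open>A\<close> and \<open>mat_adj A\<close> have conjugate quadratic forms, which
  agree once they are real; \<open>polarization\<close> then recovers every entry from the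
  form.\<close>

lemma hermitian_if_quadratic_form_real:
  assumes "\<And>v. cinner (A *v v) v \<in> \<real>"
  shows "mat_adj A = A"
proof -
  have 1: "cinner (A *v v) v = cinner (mat_adj A *v v) v" for v
    using assms[of v] cinner_commute[of "mat_adj A *v v" v]
    by (metis Reals_cnj_iff cinner_mat_adj)
  have "A $ i $ j = mat_adj A $ i $ j" for i j
    unfolding polarization[of A] polarization[of "mat_adj A"] 1 ..
  then show ?thesis
    by (simp add: vec_eq_iff)
qed

lemma nonneg_matrix_hermitian:
  assumes "nonneg_matrix A"
  shows "mat_adj A = A"
proof (rule hermitian_if_quadratic_form_real)
  show "cinner (A *v v) v \<in> \<real>" for v
    using assms nonneg_Reals_subset_Reals unfolding nonneg_matrix_def by blast
qed

lemma nonneg_matrix_Re: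
  assumes "nonneg_matrix A"
  shows "0 \<le> Re (cinner (A *v v) v)"
  using assms by (simp add: nonneg_matrix_def complex_nonneg_Reals_iff)

text \<open>Expands the form of \<open>A\<close> at p x - w and divides by p. The weight is free so
  that p can become the Poisson kernel at \<xi>, where the term in x cancels against its twin in the
  real part of H + I.\<close>

lemma nonneg_matrix_young:
  assumes A: "nonneg_matrix A" and p: "p > 0"
  shows "2 * Re (cinner (A *v w) x) \<le> p * Re (cinner (A *v x) x) + Re (cinner (A *v w) w) / p"
proof -
  have "cinner (A *v x) w = cnj (cinner (A *v w) x)"
    using nonneg_matrix_hermitian[OF A] by (metis cinner_commute cinner_mat_adj)
  then have "Re (cinner (A *v (complex_of_real p *s x - w)) (complex_of_real p *s x - w)) =
      p * (p * Re (cinner (A *v x) x)) - 2 * (p * Re (cinner (A *v w) x)) + Re (cinner (A *v w) w)"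
    by (simp add: matrix_vector_mult_diff_distrib vector_scalar_commute
        cinner_diff_left cinner_diff_right cinner_scale_left cinner_scale_right algebra_simps)
  with nonneg_matrix_Re[OF A, of "complex_of_real p *s x - w"] p show ?thesis
    by (simp add: field_simps)
qed

text \<open>The constant term of the Herglotz representation is skew-adjoint, so it disappears from
  every real part below.\<close>

lemma Re_cinner_im_part:
  "Re (cinner (cscale \<i> (im_part A) *v x) x) = 0"
  using Re_cinner_mat_adj[of A x]
  by (simp add: im_part_def cscale_mult_vec cinner_scale_left matrix_vector_mult_diff_rdistrib
      cinner_diff_left)

subsection \<open>Moore--Penrose inverses and orthogonal projections\<close>

text \<open>\<open>A ** X\<close> and \<open>A ** Y\<close> are self-adjoint and absorb each other
  because A X A = A = A Y A; taking adjoints swaps the factors and forces equality. The same on the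
  other side leaves X = X A X = Y A Y = Y.\<close>

lemma moore_penrose_unique:
  assumes X: "is_moore_penrose A X" and Y: "is_moore_penrose A Y"
  shows "X = Y"
proof -
  have "A ** X = (A ** Y) ** (A ** X)"
    using Y by (metis is_moore_penrose_def matrix_mul_assoc)
  also have "\<dots> = mat_adj (A ** X ** A ** Y)"
    using X Y unfolding is_moore_penrose_def by (metis mat_adj_mult matrix_mul_assoc)
  also have "\<dots> = A ** Y"
    using X Y unfolding is_moore_penrose_def by metis
  finally have 1: "A ** X = A ** Y" .
  have "X ** A = (X ** A) ** (Y ** A)"
    using Y by (metis is_moore_penrose_def matrix_mul_assoc)
  also have "\<dots> = mat_adj (Y ** (A ** X ** A))"
    using X Y unfolding is_moore_penrose_def by (metis mat_adj_mult matrix_mul_assoc)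
  also have "\<dots> = Y ** A"
    using X Y unfolding is_moore_penrose_def by metis
  finally have 2: "X ** A = Y ** A" .
  have "X = X ** A ** X" "Y = Y ** A ** Y"
    using X Y unfolding is_moore_penrose_def by auto
  then show ?thesis
    using 1 2 by (metis matrix_mul_assoc)
qed

lemma moore_penrose_inverse_eq:
  "is_moore_penrose A X \<Longrightarrow> moore_penrose_inverse A = X"
  unfolding moore_penrose_inverse_def using moore_penrose_unique by blast

text \<open>The Penrose conditions are symmetric in the two matrices, and the scalars cancel in
  pairs. Thus the inverse of the limit cnj \<xi> X is read off as \<xi> M.\<close>

lemma is_moore_penrose_cscale_sym:
  assumes X: "is_moore_penrose A X" and cd: "c * d = 1"
  shows "is_moore_penrose (cscale c X) (cscale d A)"
proof -
  have "d * c = 1" using cd by (simp add: mult.commute)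
  with X cd show ?thesis
    unfolding is_moore_penrose_def
    by (simp add: cscale_mult_left cscale_mult_right)
qed

text \<open>A projection fixes its range, so Q P = P and P Q = Q; the adjoint of the first equation
  is P Q = P. This justifies the definite description in \<open>orth_proj\<close>.\<close>

lemma orth_proj_unique:
  assumes "P ** P = P" "mat_adj P = P" "Q ** Q = Q" "mat_adj Q = Q"
    and "range ((*v) P) = range ((*v) (Q :: complex ^ 'n ^ 'n))"
  shows "P = Q"
proof -
  have absorb: "S ** R = R" if S: "S ** S = S" and sub: "range ((*v) R) \<subseteq> range ((*v) S)"
    for R S :: "complex ^ 'n ^ 'n"
  proof -
    have "S *v (R *v x) = R *v x" for x
    proof -
      obtain y where "R *v x = S *v y" using sub by blast
      then show ?thesis using S by (simp add: matrix_vector_mul_assoc)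
    qed
    then show ?thesis
      by (simp add: matrix_eq matrix_vector_mul_assoc)
  qed
  have "Q ** P = P" "P ** Q = Q"
    using assms by (auto intro!: absorb)
  then show ?thesis
    using assms by (metis mat_adj_mult)
qed

lemma orth_proj_eq:
  "P ** P = P \<Longrightarrow> mat_adj P = P \<Longrightarrow> orth_proj (range ((*v) P)) = P"
  unfolding orth_proj_def by (rule the_equality) (auto intro!: orth_proj_unique)

text \<open>M is injective on its own range, since M M x = 0 gives |M x|^2 = <M M x, x> = 0; Y is a
  linear left inverse of M there, extended to the whole space. It takes the place of a spectral
  decomposition.\<close>

lemma hermitian_left_inverse_on_range:
  fixes M :: "complex ^ 'n ^ 'n"
  assumes M: "mat_adj M = M"
  shows "\<exists>Y. Y ** M ** M = M"
proof -
  have "inj_on ((*v) M) (range ((*v) M))"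
  proof (rule inj_onI, clarify)
    fix x y assume "M *v (M *v x) = M *v (M *v y)"
    then have 0: "M *v (M *v (x - y)) = 0"
      by (simp add: matrix_vector_mult_diff_distrib)
    have "cinner (M *v (x - y)) (M *v (x - y)) = cinner (M *v (M *v (x - y))) (x - y)"
      by (metis M cinner_mat_adj)
    then show "M *v x = M *v y"
      unfolding 0 cinner_self by (simp add: matrix_vector_mult_diff_distrib)
  qed
  then obtain g where g: "Vector_Spaces.linear (*s) (*s) g" "\<forall>v\<in>range ((*v) M). g (M *v v) = v"
    using vec.linear_exists_left_inverse_on[OF matrix_vector_mul_linear_gen,
        OF vec.subspace_image[OF vec.subspace_UNIV]] by blast
  have "matrix g ** M ** M = M"
    using g by (simp add: matrix_eq matrix_vector_mul_assoc[symmetric] matrix_works)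
  then show ?thesis ..
qed

text \<open>Although Y is arbitrary off the range of M, P = Y M is an orthogonal projection: the
  adjoint of Y M M = M turns P \<open>mat_adj P\<close> = Y M M \<open>mat_adj Y\<close> into P. The
  matrix X = Y P also equals P \<open>mat_adj Y\<close>, and the two forms give X M = P and M X =
  P.\<close>

lemma hermitian_moore_penrose:
  assumes M: "mat_adj M = M"
  obtains X where "is_moore_penrose M X" "M ** X = X ** M"
proof -
  obtain Y where Y: "Y ** M ** M = M"
    using hermitian_left_inverse_on_range[OF M] ..
  define P where "P = Y ** M"
  have Y': "M ** M ** mat_adj Y = M"
    using arg_cong[OF Y, of mat_adj] by (simp add: mat_adj_mult M matrix_mul_assoc)
  have PM: "P ** M = M" by (simp add: P_def Y)
  have adjP: "mat_adj P = M ** mat_adj Y" by (simp add: P_def mat_adj_mult M)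
  have "P ** mat_adj P = Y ** (M ** M ** mat_adj Y)"
    unfolding adjP by (simp add: P_def matrix_mul_assoc)
  then have PP: "P ** mat_adj P = P"
    by (simp add: Y' P_def)
  then have herm: "mat_adj P = P"
    using mat_adj_mult[of P "mat_adj P"] by simp
  have idem: "P ** P = P" using PP unfolding herm .
  have MP: "M ** P = M"
    using arg_cong[OF PM, of mat_adj] by (simp add: mat_adj_mult herm M)
  define X where "X = Y ** P"
  have X': "X = P ** mat_adj Y"
    using adjP unfolding X_def herm by (simp add: P_def matrix_mul_assoc)
  have "X ** M = Y ** (P ** M)" by (simp add: X_def matrix_mul_assoc)
  then have XM: "X ** M = P" unfolding PM P_def[symmetric] .
  have "M ** X = (M ** P) ** mat_adj Y" unfolding X' by (rule matrix_mul_assoc)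
  then have MX: "M ** X = P" unfolding MP adjP[symmetric] herm .
  have "P ** X = (P ** P) ** mat_adj Y" unfolding X' by (rule matrix_mul_assoc)
  then have PX: "P ** X = X" unfolding idem X'[symmetric] .
  have "is_moore_penrose M X"
    unfolding is_moore_penrose_def XM MX PM PX herm by simp
  then show thesis using that MX XM by simp
qed

section \<open>Integration against a non-negative matrix measure\<close>

text \<open>Boundedness is asked on the circle only, where the measures live:
  \<open>herglotz z\<close> with z nonzero has a pole in the disc. Such functions are integrable
  against every \<open>quad_measure\<close> and closed under products and conjugation, as the
  Cauchy-Schwarz inequality requires.\<close>

definition bounded_borel :: "(complex \<Rightarrow> complex) \<Rightarrow> bool" where
  "bounded_borel f \<longleftrightarrow> f \<in> borel_measurable circle_borel \<and> (\<exists>B. \<forall>\<zeta>\<in>sphere 0 1. cmod (f \<zeta>) \<le> B)"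

lemma bounded_borelI:
  assumes "f \<in> borel_measurable circle_borel" "\<And>\<zeta>. \<zeta> \<in> sphere 0 1 \<Longrightarrow> cmod (f \<zeta>) \<le> B"
  shows "bounded_borel f"
  using assms unfolding bounded_borel_def by blast

lemma bounded_borel_measurable [measurable_dest]: "bounded_borel f \<Longrightarrow> f \<in> borel_measurable circle_borel"
  by (simp add: bounded_borel_def)

lemma bounded_borel_add:
  assumes "bounded_borel f" "bounded_borel g"
  shows "bounded_borel (\<lambda>\<zeta>. f \<zeta> + g \<zeta>)"
proof -
  obtain B C where "\<And>\<zeta>. \<zeta> \<in> sphere 0 1 \<Longrightarrow> cmod (f \<zeta>) \<le> B" "\<And>\<zeta>. \<zeta> \<in> sphere 0 1 \<Longrightarrow> cmod (g \<zeta>) \<le> C"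
    using assms unfolding bounded_borel_def by blast
  then show ?thesis
    using assms[THEN bounded_borel_measurable]
    by (intro bounded_borelI[where B = "B + C"]) (auto intro: norm_triangle_mono)
qed

lemma bounded_borel_mult:
  assumes "bounded_borel f" "bounded_borel g"
  shows "bounded_borel (\<lambda>\<zeta>. f \<zeta> * g \<zeta>)"
proof -
  obtain B C where BC: "\<And>\<zeta>. \<zeta> \<in> sphere 0 1 \<Longrightarrow> cmod (f \<zeta>) \<le> B" "\<And>\<zeta>. \<zeta> \<in> sphere 0 1 \<Longrightarrow> cmod (g \<zeta>) \<le> C"
    using assms unfolding bounded_borel_def by blast
  show ?thesis
  proof (rule bounded_borelI[where B = "B * C"])
    show "cmod (f \<zeta> * g \<zeta>) \<le> B * C" if "\<zeta> \<in> sphere 0 1" for \<zeta>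
      unfolding norm_mult by (intro mult_mono BC that order_trans[OF norm_ge_zero BC(1)[OF that]]) auto
  qed (use assms[THEN bounded_borel_measurable] in measurable)
qed

lemma bounded_borel_cnj:
  assumes "bounded_borel f"
  shows "bounded_borel (\<lambda>\<zeta>. cnj (f \<zeta>))"
proof -
  have "cnj \<in> borel_measurable borel"
    by (intro borel_measurable_continuous_onI continuous_intros)
  then show ?thesis
    using assms unfolding bounded_borel_def by (auto intro: measurable_compose)
qed

lemma bounded_borel_const [simp]: "bounded_borel (\<lambda>\<zeta>. c)"
  by (rule bounded_borelI[where B = "cmod c"]) auto

lemma bounded_borel_simple_function:
  assumes "simple_function circle_borel u"
  shows "bounded_borel u"
proof -
  have "finite (u ` sphere 0 1)"
    using assms by (simp add: simple_function_def space_restrict_space)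
  then have "finite (cmod ` u ` sphere 0 1)" by blast
  then show ?thesis
    using assms by (intro bounded_borelI[where B = "Max (cmod ` u ` sphere 0 1)"])
      (auto intro: Max_ge borel_measurable_simple_function)
qed

lemma bounded_borel_continuous:
  assumes f: "continuous_on (sphere 0 1) f"
  shows "bounded_borel f"
proof -
  have "compact (f ` sphere 0 1)"
    by (intro compact_continuous_image f compact_sphere)
  then obtain B where "\<forall>x\<in>f ` sphere 0 1. cmod x \<le> B"
    using compact_imp_bounded bounded_iff by metis
  then show ?thesis
    using f by (intro bounded_borelI[where B = B] borel_measurable_continuous_on_restrict) auto
qed

section \<open>The matrix integral: linearity, dominated convergence, simple functions\<close>

lemma sets_quad_measure: "sets (quad_measure \<mu> v) = sets circle_borel"
  unfolding quad_measure_def using sets.sigma_sets_eq[of circle_borel] sets.space_closed[of circle_borel]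
  by (subst sets_measure_of) (auto simp: space_restrict_space)

lemma space_quad_measure: "space (quad_measure \<mu> v) = sphere 0 1"
  using sets_eq_imp_space_eq[OF sets_quad_measure] by (simp add: space_restrict_space)

lemma matrix_integral_cong:
  assumes "\<And>\<zeta>. \<zeta> \<in> sphere 0 1 \<Longrightarrow> f \<zeta> = g \<zeta>"
  shows "matrix_integral \<mu> f = matrix_integral \<mu> g"
proof -
  have "integral\<^sup>L (quad_measure \<mu> v) f = integral\<^sup>L (quad_measure \<mu> v) g" for v
    using assms by (intro Bochner_Integration.integral_cong) (auto simp: space_quad_measure)
  then show ?thesis by (simp add: matrix_integral_def)
qed

locale nonneg_matrix_measure_space =
  fixes \<mu> :: "complex set \<Rightarrow> complex ^ 'n ^ 'n"
  assumes nonneg_measure: "nonneg_matrix_measure \<mu>"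
begin

lemma finite_quad_measure: "finite_measure (quad_measure \<mu> v)"
proof
  have "space circle_borel \<in> sets circle_borel" by (rule sets.top)
  then show "emeasure (quad_measure \<mu> v) (space (quad_measure \<mu> v)) \<noteq> \<infinity>"
    using emeasure_quad_measure[OF nonneg_measure, of "sphere 0 1" v]
    by (simp add: space_quad_measure space_restrict_space)
qed

lemma bounded_borel_measurable_quad: "bounded_borel f \<Longrightarrow> f \<in> borel_measurable (quad_measure \<mu> v)"
  using measurable_cong_sets[OF sets_quad_measure refl] unfolding bounded_borel_def by blast

lemma integrable_bounded_borel:
  assumes "bounded_borel f"
  shows "integrable (quad_measure \<mu> v) f"
proof -
  obtain B where "\<forall>\<zeta>\<in>sphere 0 1. cmod (f \<zeta>) \<le> B"
    using assms unfolding bounded_borel_def by blast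
  then show ?thesis
    using bounded_borel_measurable_quad[OF assms]
    by (intro finite_measure.integrable_const_bound[OF finite_quad_measure, where B = B] AE_I2)
       (auto simp: space_quad_measure)
qed

lemma matrix_integral_linear:
  assumes f: "bounded_borel f" and g: "bounded_borel g"
  shows "matrix_integral \<mu> (\<lambda>\<zeta>. c * f \<zeta> + g \<zeta>) = cscale c (matrix_integral \<mu> f) + matrix_integral \<mu> g"
proof -
  have "integral\<^sup>L (quad_measure \<mu> v) (\<lambda>\<zeta>. c * f \<zeta> + g \<zeta>) =
      c * integral\<^sup>L (quad_measure \<mu> v) f + integral\<^sup>L (quad_measure \<mu> v) g" for v
    using integrable_bounded_borel[OF f] integrable_bounded_borel[OF g] by simp
  then show ?thesis
    by (simp add: matrix_integral_def cscale_def vec_eq_iff sum.distrib sum_distrib_left algebra_simps)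
qed

lemma matrix_integral_zero [simp]: "matrix_integral \<mu> (\<lambda>\<zeta>. 0) = 0"
  by (simp add: matrix_integral_def vec_eq_iff)

lemma matrix_integral_scale:
  assumes "bounded_borel f"
  shows "matrix_integral \<mu> (\<lambda>\<zeta>. c * f \<zeta>) = cscale c (matrix_integral \<mu> f)"
  using matrix_integral_linear[OF assms bounded_borel_const[of 0], of c] by simp

lemma tendsto_matrix_integral:
  assumes f: "\<And>k. bounded_borel (f k)" and g: "bounded_borel g"
    and bound: "\<And>k \<zeta>. \<zeta> \<in> sphere 0 1 \<Longrightarrow> cmod (f k \<zeta>) \<le> B"
    and lim: "\<And>\<zeta>. \<zeta> \<in> sphere 0 1 \<Longrightarrow> (\<lambda>k. f k \<zeta>) \<longlonglongrightarrow> g \<zeta>"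
  shows "(\<lambda>k. matrix_integral \<mu> (f k)) \<longlonglongrightarrow> matrix_integral \<mu> g"
proof -
  have "(\<lambda>k. integral\<^sup>L (quad_measure \<mu> v) (f k)) \<longlonglongrightarrow> integral\<^sup>L (quad_measure \<mu> v) g" for v
  proof (rule integral_dominated_convergence[where w = "\<lambda>_. B"])
    show "integrable (quad_measure \<mu> v) (\<lambda>_. B)"
      by (rule finite_measure.integrable_const[OF finite_quad_measure])
  qed (use f g bound lim bounded_borel_measurable_quad in \<open>auto intro!: AE_I2 simp: space_quad_measure\<close>)
  then show ?thesis
    by (auto intro!: vec_tendstoI tendsto_intros simp: matrix_integral_def)
qed

lemma tendsto_cinner_matrix_integral:
  assumes "\<And>k. bounded_borel (f k)" "bounded_borel g"
    and "\<And>k \<zeta>. \<zeta> \<in> sphere 0 1 \<Longrightarrow> cmod (f k \<zeta>) \<le> B"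
    and "\<And>\<zeta>. \<zeta> \<in> sphere 0 1 \<Longrightarrow> (\<lambda>k. f k \<zeta>) \<longlonglongrightarrow> g \<zeta>"
  shows "(\<lambda>k. cinner (matrix_integral \<mu> (f k) *v x) y) \<longlonglongrightarrow> cinner (matrix_integral \<mu> g *v x) y"
  unfolding cinner_def matrix_vector_mult_def
  by (auto intro!: tendsto_intros tendsto_vec_nth tendsto_matrix_integral[OF assms])

lemma cinner_matrix_integral_linear:
  assumes "bounded_borel f" "bounded_borel g"
  shows "cinner (matrix_integral \<mu> (\<lambda>\<zeta>. c * f \<zeta> + g \<zeta>) *v x) y =
    c * cinner (matrix_integral \<mu> f *v x) y + cinner (matrix_integral \<mu> g *v x) y"
  by (simp add: matrix_integral_linear[OF assms] matrix_vector_mult_add_rdistrib cinner_add_left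
      cscale_mult_vec cinner_scale_left)

lemma bounded_borel_indicator:
  "A \<in> sets circle_borel \<Longrightarrow> bounded_borel (indicator A)"
  by (rule bounded_borelI[where B = 1]) (auto simp: indicator_def)

text \<open>Boundedness is proved along with the formula because the linearity used in the induction
  step requires it of the partial sum.\<close>

lemma cinner_matrix_integral_sum_indicator:
  assumes "finite I" "\<And>i. i \<in> I \<Longrightarrow> A i \<in> sets circle_borel"
  shows "bounded_borel (\<lambda>\<zeta>. \<Sum>i\<in>I. c i * indicator (A i) \<zeta>) \<and>
    cinner (matrix_integral \<mu> (\<lambda>\<zeta>. \<Sum>i\<in>I. c i * indicator (A i) \<zeta>) *v x) y =
    (\<Sum>i\<in>I. c i * cinner (\<mu> (A i) *v x) y)"
  using assms
proof (induction I)
  case (insert i I)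
  then have ind: "bounded_borel (indicator (A i))" and \<mu>: "matrix_integral \<mu> (indicator (A i)) = \<mu> (A i)"
    using bounded_borel_indicator[of "A i"] matrix_integral_indicator[OF nonneg_measure, of "A i"] by auto
  have IH: "bounded_borel (\<lambda>\<zeta>. \<Sum>i\<in>I. c i * indicator (A i) \<zeta>)"
    "cinner (matrix_integral \<mu> (\<lambda>\<zeta>. \<Sum>i\<in>I. c i * indicator (A i) \<zeta>) *v x) y =
      (\<Sum>i\<in>I. c i * cinner (\<mu> (A i) *v x) y)"
    using insert by blast+
  show ?case
    unfolding sum.insert[OF insert(1,2)] cinner_matrix_integral_linear[OF ind IH(1)] IH(2) \<mu>
    by (intro conjI bounded_borel_add bounded_borel_mult ind IH bounded_borel_const refl)
qed simp

text \<open>The sum runs over the level sets of \<open>u\<close>, not of the composite, so that one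
  partition serves several \<phi> at once.\<close>

lemma cinner_matrix_integral_simple:
  assumes u: "simple_function circle_borel u"
  shows "cinner (matrix_integral \<mu> (\<lambda>\<zeta>. \<phi> (u \<zeta>)) *v x) y =
    (\<Sum>c\<in>u ` sphere 0 1. \<phi> c * cinner (\<mu> (u -` {c} \<inter> sphere 0 1) *v x) y)"
proof -
  have fin: "finite (u ` sphere 0 1)"
    using u by (simp add: simple_function_def space_restrict_space)
  have sets: "u -` {c} \<inter> sphere 0 1 \<in> sets circle_borel" if "c \<in> u ` sphere 0 1" for c
    using u that by (auto simp: simple_function_def space_restrict_space)
  have expand: "\<phi> (u \<zeta>) = (\<Sum>c\<in>u ` sphere 0 1. \<phi> c * indicator (u -` {c} \<inter> sphere 0 1) \<zeta>)"
    if "\<zeta> \<in> sphere 0 1" for \<zeta>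
  proof -
    have "(\<Sum>c\<in>u ` sphere 0 1. \<phi> c * indicator (u -` {c} \<inter> sphere 0 1) \<zeta>) =
        (\<Sum>c\<in>u ` sphere 0 1. if c = u \<zeta> then \<phi> c else 0)"
      using that by (intro sum.cong) (auto simp: indicator_def)
    also have "\<dots> = \<phi> (u \<zeta>)"
      using fin that by simp
    finally show ?thesis ..
  qed
  have "matrix_integral \<mu> (\<lambda>\<zeta>. \<phi> (u \<zeta>)) =
      matrix_integral \<mu> (\<lambda>\<zeta>. \<Sum>c\<in>u ` sphere 0 1. \<phi> c * indicator (u -` {c} \<inter> sphere 0 1) \<zeta>)"
    by (rule matrix_integral_cong) (rule expand)
  then show ?thesis
    using cinner_matrix_integral_sum_indicator[where I = "u ` sphere 0 1"
        and A = "\<lambda>c. u -` {c} \<inter> sphere 0 1" and c = \<phi>, OF fin sets] by simp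
qed

subsection \<open>Positivity and the Cauchy--Schwarz inequality\<close>

text \<open>Formally this is \<open>\<integral> \<langle>d\<mu> (g x + h y), g x + h y\<rangle>\<close>.\<close>
definition gram :: "(complex \<Rightarrow> complex) \<Rightarrow> (complex \<Rightarrow> complex) \<Rightarrow> complex ^ 'n \<Rightarrow> complex ^ 'n \<Rightarrow> complex"
  where
  "gram g h x y =
     cinner (matrix_integral \<mu> (\<lambda>\<zeta>. g \<zeta> * cnj (g \<zeta>)) *v x) x +
     cinner (matrix_integral \<mu> (\<lambda>\<zeta>. g \<zeta> * cnj (h \<zeta>)) *v x) y +
     cinner (matrix_integral \<mu> (\<lambda>\<zeta>. h \<zeta> * cnj (g \<zeta>)) *v y) x +
     cinner (matrix_integral \<mu> (\<lambda>\<zeta>. h \<zeta> * cnj (h \<zeta>)) *v y) y"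

text \<open>Both functions are constant on the level sets A of the pair \<open>u\<close>. Regrouping
  the four integrals over this common partition leaves the forms of the matrices \<mu>(A) at vectors
  c x + d y, each of them non-negative.\<close>

lemma gram_nonneg_simple:
  assumes g: "simple_function circle_borel g" and h: "simple_function circle_borel h"
  shows "gram g h x y \<in> \<real>\<^sub>\<ge>\<^sub>0"
proof -
  define u where "u = (\<lambda>\<zeta>. (g \<zeta>, h \<zeta>))"
  have u: "simple_function circle_borel u"
    unfolding u_def using g h by auto
  define A where "A = (\<lambda>c. u -` {c} \<inter> sphere 0 1)"
  have A: "A c \<in> sets circle_borel" if "c \<in> u ` sphere 0 1" for c
    using u that unfolding A_def by (auto simp: simple_function_def space_restrict_space)
  have S: "cinner (matrix_integral \<mu> (\<lambda>\<zeta>. \<phi> (u \<zeta>)) *v v) w =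
      (\<Sum>c\<in>u ` sphere 0 1. \<phi> c * cinner (\<mu> (A c) *v v) w)" for \<phi> v w
    unfolding A_def by (rule cinner_matrix_integral_simple[OF u])
  have "gram g h x y = (\<Sum>c\<in>u ` sphere 0 1. cinner (\<mu> (A c) *v (fst c *s x + snd c *s y)) (fst c *s x + snd c *s y))"
    unfolding gram_def
    using S[of "\<lambda>c. fst c * cnj (fst c)" x x] S[of "\<lambda>c. fst c * cnj (snd c)" x y]
      S[of "\<lambda>c. snd c * cnj (fst c)" y x] S[of "\<lambda>c. snd c * cnj (snd c)" y y]
    by (simp add: u_def sum.distrib[symmetric] matrix_vector_right_distrib vector_scalar_commute
        cinner_add_left cinner_add_right cinner_scale_left cinner_scale_right algebra_simps)
  also have "\<dots> \<in> \<real>\<^sub>\<ge>\<^sub>0"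
    using nonneg_measure A
    by (auto simp: complex_nonneg_Reals_iff nonneg_matrix_measure_def nonneg_matrix_def intro!: sum_nonneg)
  finally show ?thesis .
qed

lemma bounded_simple_approximation:
  assumes g: "bounded_borel g"
  obtains G B where "\<And>k. simple_function circle_borel (G k)" "\<And>k. bounded_borel (G k)"
    "\<And>k \<zeta>. \<zeta> \<in> sphere 0 1 \<Longrightarrow> cmod (G k \<zeta>) \<le> B"
    "\<And>\<zeta>. \<zeta> \<in> sphere 0 1 \<Longrightarrow> (\<lambda>k. G k \<zeta>) \<longlonglongrightarrow> g \<zeta>"
proof -
  obtain B where B: "\<forall>\<zeta>\<in>sphere 0 1. cmod (g \<zeta>) \<le> B"
    using g unfolding bounded_borel_def by blast
  have sp: "space circle_borel = sphere 0 1" by (simp add: space_restrict_space)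
  obtain G where G: "\<forall>k. simple_function circle_borel (G k)"
    "\<forall>\<zeta>\<in>space circle_borel. (\<lambda>k. G k \<zeta>) \<longlonglongrightarrow> g \<zeta>"
    "\<forall>k. \<forall>\<zeta>\<in>space circle_borel. dist (G k \<zeta>) 0 \<le> 2 * dist (g \<zeta>) 0"
    using borel_measurable_implies_sequence_metric[OF bounded_borel_measurable[OF g], of 0] by blast
  \<comment> \<open>The approximants satisfy |G k| \<le> 2 |g| because the base point is 0, whence
    the factor 2.\<close>
  show thesis
  proof (rule that[of G "2 * B"])
    fix k \<zeta> assume \<zeta>: "\<zeta> \<in> sphere (0::complex) 1"
    then have "cmod (G k \<zeta>) \<le> 2 * cmod (g \<zeta>)"
      using G(3) by (simp add: sp)
    also have "\<dots> \<le> 2 * B"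
      using B \<zeta> by simp
    finally show "cmod (G k \<zeta>) \<le> 2 * B" .
  qed (use G bounded_borel_simple_function in \<open>auto simp: sp\<close>)
qed

text \<open>Positivity passes from simple to bounded Borel functions by dominated convergence, the
  non-negative reals being closed.\<close>

lemma gram_nonneg:
  assumes g: "bounded_borel g" and h: "bounded_borel h"
  shows "gram g h x y \<in> \<real>\<^sub>\<ge>\<^sub>0"
proof -
  obtain G B where G: "\<And>k. simple_function circle_borel (G k)" "\<And>k. bounded_borel (G k)"
    "\<And>k \<zeta>. \<zeta> \<in> sphere 0 1 \<Longrightarrow> cmod (G k \<zeta>) \<le> B"
    "\<And>\<zeta>. \<zeta> \<in> sphere 0 1 \<Longrightarrow> (\<lambda>k. G k \<zeta>) \<longlonglongrightarrow> g \<zeta>"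
    using bounded_simple_approximation[OF g] by metis
  obtain K C where K: "\<And>k. simple_function circle_borel (K k)" "\<And>k. bounded_borel (K k)"
    "\<And>k \<zeta>. \<zeta> \<in> sphere 0 1 \<Longrightarrow> cmod (K k \<zeta>) \<le> C"
    "\<And>\<zeta>. \<zeta> \<in> sphere 0 1 \<Longrightarrow> (\<lambda>k. K k \<zeta>) \<longlonglongrightarrow> h \<zeta>"
    using bounded_simple_approximation[OF h] by metis
  have conv: "(\<lambda>k. cinner (matrix_integral \<mu> (\<lambda>\<zeta>. P k \<zeta> * cnj (Q k \<zeta>)) *v v) w) \<longlonglongrightarrow>
      cinner (matrix_integral \<mu> (\<lambda>\<zeta>. p \<zeta> * cnj (q \<zeta>)) *v v) w"
    if "\<And>k. bounded_borel (P k)" "\<And>k. bounded_borel (Q k)" "bounded_borel p" "bounded_borel q"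
      and P: "\<And>k \<zeta>. \<zeta> \<in> sphere 0 1 \<Longrightarrow> cmod (P k \<zeta>) \<le> D" "\<And>k \<zeta>. \<zeta> \<in> sphere 0 1 \<Longrightarrow> cmod (Q k \<zeta>) \<le> D'"
      and lim: "\<And>\<zeta>. \<zeta> \<in> sphere 0 1 \<Longrightarrow> (\<lambda>k. P k \<zeta>) \<longlonglongrightarrow> p \<zeta>" "\<And>\<zeta>. \<zeta> \<in> sphere 0 1 \<Longrightarrow> (\<lambda>k. Q k \<zeta>) \<longlonglongrightarrow> q \<zeta>"
    for P Q p q D D' v w
  proof (rule tendsto_cinner_matrix_integral[where B = "D * D'"])
    fix k \<zeta> assume z: "\<zeta> \<in> sphere (0::complex) 1"
    show "cmod (P k \<zeta> * cnj (Q k \<zeta>)) \<le> D * D'"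
      unfolding norm_mult complex_mod_cnj
      by (intro mult_mono P z order_trans[OF norm_ge_zero P(1)[OF z]]) auto
  qed (use that in \<open>auto intro!: bounded_borel_mult bounded_borel_cnj tendsto_intros\<close>)
  have "(\<lambda>k. gram (G k) (K k) x y) \<longlonglongrightarrow> gram g h x y"
    unfolding gram_def by (intro tendsto_add conv[OF G(2) G(2) g g] conv[OF G(2) K(2) g h]
        conv[OF K(2) G(2) h g] conv[OF K(2) K(2) h h]) (use G K in blast)+
  then show ?thesis
    using gram_nonneg_simple[OF G(1) K(1)]
    by (intro Lim_in_closed_set[OF closed_nonneg_Reals_complex]) auto
qed

lemma matrix_integral_norm_sq_nonneg:
  assumes g: "bounded_borel g"
  shows "cinner (matrix_integral \<mu> (\<lambda>\<zeta>. g \<zeta> * cnj (g \<zeta>)) *v x) x \<in> \<real>\<^sub>\<ge>\<^sub>0"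
  using gram_nonneg[OF g bounded_borel_const[of 0], of x 0] by (simp add: gram_def)

text \<open>On the circle f = g * cnj g with g = sqrt f, to which
  \<open>matrix_integral_norm_sq_nonneg\<close> applies.\<close>

lemma nonneg_matrix_integral:
  assumes f: "bounded_borel (\<lambda>\<zeta>. complex_of_real (f \<zeta>))" and pos: "\<And>\<zeta>. \<zeta> \<in> sphere 0 1 \<Longrightarrow> 0 \<le> f \<zeta>"
  shows "nonneg_matrix (matrix_integral \<mu> (\<lambda>\<zeta>. complex_of_real (f \<zeta>)))"
proof -
  obtain B where B: "\<forall>\<zeta>\<in>sphere 0 1. cmod (complex_of_real (f \<zeta>)) \<le> B"
    using f unfolding bounded_borel_def by blast
  have "bounded_borel (\<lambda>\<zeta>. complex_of_real (sqrt (f \<zeta>)))"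
  proof (rule bounded_borelI[where B = "sqrt B"])
    \<comment> \<open>Inserting \<open>Re\<close> exhibits the function as a composite with the
      complex-valued one, whose measurability is what the hypothesis provides.\<close>
    have "(\<lambda>\<zeta>. complex_of_real (sqrt (Re (complex_of_real (f \<zeta>))))) \<in> borel_measurable circle_borel"
      using bounded_borel_measurable[OF f] by measurable
    then show "(\<lambda>\<zeta>. complex_of_real (sqrt (f \<zeta>))) \<in> borel_measurable circle_borel"
      by simp
  qed (use B pos in \<open>auto simp: abs_of_nonneg\<close>)
  from matrix_integral_norm_sq_nonneg[OF this]
  have "nonneg_matrix (matrix_integral \<mu> (\<lambda>\<zeta>. complex_of_real (sqrt (f \<zeta>)) * cnj (complex_of_real (sqrt (f \<zeta>)))))"
    unfolding nonneg_matrix_def by blast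
  also have "matrix_integral \<mu> (\<lambda>\<zeta>. complex_of_real (sqrt (f \<zeta>)) * cnj (complex_of_real (sqrt (f \<zeta>)))) =
      matrix_integral \<mu> (\<lambda>\<zeta>. complex_of_real (f \<zeta>))"
    using pos by (intro matrix_integral_cong) (simp flip: of_real_mult)
  finally show ?thesis .
qed

text \<open>The \<open>gram\<close> form at s x and t y is a non-negative form in the scalars s, t
  with coefficients a, c, d, b; the claim is that its determinant is non-negative.\<close>

lemma matrix_integral_cauchy_schwarz:
  assumes g: "bounded_borel g" and h: "bounded_borel h"
  shows "(cmod (cinner (matrix_integral \<mu> (\<lambda>\<zeta>. g \<zeta> * cnj (h \<zeta>)) *v x) y))\<^sup>2 \<le>
    Re (cinner (matrix_integral \<mu> (\<lambda>\<zeta>. g \<zeta> * cnj (g \<zeta>)) *v x) x) *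
    Re (cinner (matrix_integral \<mu> (\<lambda>\<zeta>. h \<zeta> * cnj (h \<zeta>)) *v y) y)"
proof -
  define c where "c = cinner (matrix_integral \<mu> (\<lambda>\<zeta>. g \<zeta> * cnj (h \<zeta>)) *v x) y"
  define d where "d = cinner (matrix_integral \<mu> (\<lambda>\<zeta>. h \<zeta> * cnj (g \<zeta>)) *v y) x"
  define a where "a = Re (cinner (matrix_integral \<mu> (\<lambda>\<zeta>. g \<zeta> * cnj (g \<zeta>)) *v x) x)"
  define b where "b = Re (cinner (matrix_integral \<mu> (\<lambda>\<zeta>. h \<zeta> * cnj (h \<zeta>)) *v y) y)"
  have a: "cinner (matrix_integral \<mu> (\<lambda>\<zeta>. g \<zeta> * cnj (g \<zeta>)) *v x) x = complex_of_real a" "a \<ge> 0"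
    using matrix_integral_norm_sq_nonneg[OF g, of x] unfolding a_def
    by (auto simp: complex_nonneg_Reals_iff complex_eq_iff)
  have b: "cinner (matrix_integral \<mu> (\<lambda>\<zeta>. h \<zeta> * cnj (h \<zeta>)) *v y) y = complex_of_real b" "b \<ge> 0"
    using matrix_integral_norm_sq_nonneg[OF h, of y] unfolding b_def
    by (auto simp: complex_nonneg_Reals_iff complex_eq_iff)
  have gram: "s * cnj s * a + s * cnj t * c + t * cnj s * d + t * cnj t * b \<in> \<real>\<^sub>\<ge>\<^sub>0" for s t
    using gram_nonneg[OF g h, of "s *s x" "t *s y"]
    by (simp add: gram_def vector_scalar_commute cinner_scale_left cinner_scale_right a b
        c_def[symmetric] d_def[symmetric] mult_ac)
  \<comment> \<open>Reality of the form at (s, t) = (1, 1) and (1, \<i>) gives Im (c + d) = 0 and Re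
    (d - c) = 0.\<close>
  have d: "d = cnj c"
    using gram[of 1 1] gram[of 1 \<i>] by (simp add: complex_nonneg_Reals_iff complex_eq_iff)
  \<comment> \<open>The choice t = - c makes both cross terms real, each equal to - s |c|^2.\<close>
  have quad: "0 \<le> s\<^sup>2 * a - 2 * s * (cmod c)\<^sup>2 + (cmod c)\<^sup>2 * b" for s :: real
  proof -
    have "of_real s * cnj (of_real s) * a + of_real s * cnj (- c) * c + (- c) * cnj (of_real s) * d
        + (- c) * cnj (- c) * b = complex_of_real (s\<^sup>2 * a - 2 * s * (cmod c)\<^sup>2 + (cmod c)\<^sup>2 * b)"
      unfolding d of_real_add of_real_diff of_real_mult complex_norm_square
      by (simp add: power2_eq_square algebra_simps)
    with gram[of "of_real s" "- c"] show ?thesis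
      by (simp only: nonneg_Reals_of_real_iff)
  qed
  have "(cmod c)\<^sup>2 \<le> a * b"
  proof (cases "c = 0")
    case False
    then have c: "(cmod c)\<^sup>2 > 0" by simp
    \<comment> \<open>If a = 0 the expression is affine in s, and s = b + 1 makes it |c|^2 (- b - 2)
      < 0.\<close>
    have "a \<noteq> 0"
    proof
      assume "a = 0"
      with quad[of "b + 1"] have "0 \<le> (cmod c)\<^sup>2 * (- b - 2)" by (simp add: algebra_simps)
      with c b(2) show False by (simp add: zero_le_mult_iff)
    qed
    with a have a: "a > 0" by simp
    \<comment> \<open>This s minimises the quadratic.\<close>
    from quad[of "(cmod c)\<^sup>2 / a"] have "0 \<le> (cmod c)\<^sup>2 * (b - (cmod c)\<^sup>2 / a)"
      using a by (simp add: power2_eq_square field_simps)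
    with c have "(cmod c)\<^sup>2 / a \<le> b" by (simp add: zero_le_mult_iff)
    with a show ?thesis by (simp add: field_simps)
  qed (use a b in simp)
  then show ?thesis by (simp add: a_def b_def c_def)
qed

end

section \<open>Non-tangential limits\<close>

text \<open>The radial points z = (1 - s) \<xi> satisfy |z - \<xi>| = s = 1 - |z|, so they lie in
  every Stolz region with t > 1. Uniqueness of the limit in \<open>nt_lim\<close> rests on
  this.\<close>

lemma stolz_nontrivial:
  assumes \<xi>: "\<xi> \<in> sphere 0 1" and t: "t > 1"
  shows "at \<xi> within stolz \<xi> t \<noteq> bot"
  unfolding trivial_limit_within islimpt_approachable not_not
proof (intro allI impI)
  fix e :: real assume e: "e > 0"
  define s where "s = min (1/2) (e/2)"
  have s: "0 < s" "s < 1" "s < e" using e by (auto simp: s_def min_def)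
  have n\<xi>: "cmod \<xi> = 1" using \<xi> by simp
  have d: "cmod (complex_of_real (1 - s) * \<xi> - \<xi>) = s"
  proof -
    have "complex_of_real (1 - s) * \<xi> - \<xi> = complex_of_real (- s) * \<xi>"
      by (simp add: algebra_simps)
    then show ?thesis using s n\<xi> by (simp add: norm_mult del: of_real_minus of_real_diff)
  qed
  have n: "cmod (complex_of_real (1 - s) * \<xi>) = 1 - s"
    using s n\<xi> by (simp add: norm_mult del: of_real_minus of_real_diff)
  have "complex_of_real (1 - s) * \<xi> \<in> stolz \<xi> t"
    unfolding stolz_def using d n s t by simp
  moreover have "complex_of_real (1 - s) * \<xi> \<noteq> \<xi>" using d s by auto
  ultimately show "\<exists>x'\<in>stolz \<xi> t. x' \<noteq> \<xi> \<and> dist x' \<xi> < e"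
    using d s by (intro bexI) (auto simp: dist_norm)
qed

lemma nt_tendsto_unique:
  fixes a b :: "'a :: t2_space"
  assumes "\<xi> \<in> sphere 0 1" "nt_tendsto f a \<xi>" "nt_tendsto f b \<xi>"
  shows "a = b"
  using tendsto_unique[OF stolz_nontrivial[OF assms(1), of 2]]
    assms(2,3)[unfolded nt_tendsto_def, rule_format, of 2] by simp

lemma nt_lim_eq:
  fixes a :: "'a :: t2_space"
  assumes "\<xi> \<in> sphere 0 1" "nt_tendsto f a \<xi>"
  shows "nt_lim f \<xi> = a"
  unfolding nt_lim_def
  by (rule the_equality[of "\<lambda>L. nt_tendsto f L \<xi>", OF assms(2)]) (rule nt_tendsto_unique[OF assms(1) _ assms(2)])

text \<open>The limits of integrals come from dominated convergence along sequences, hence this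
  form.\<close>

lemma nt_tendsto_sequentiallyI:
  assumes "\<And>t z. t > 1 \<Longrightarrow> (\<And>k. z k \<in> stolz \<xi> t) \<Longrightarrow> (\<And>k. z k \<noteq> \<xi>) \<Longrightarrow> z \<longlonglongrightarrow> \<xi> \<Longrightarrow> (\<lambda>k. f (z k)) \<longlonglongrightarrow> a"
  shows "nt_tendsto f a \<xi>"
  unfolding nt_tendsto_def tendsto_at_iff_sequentially comp_def using assms by simp

lemma nt_tendsto_cong:
  assumes "\<And>z. z \<in> ball 0 1 \<Longrightarrow> f z = g z" "nt_tendsto f a \<xi>"
  shows "nt_tendsto g a \<xi>"
  unfolding nt_tendsto_def
proof (intro allI impI)
  fix t :: real assume "t > 1"
  then have "(f \<longlongrightarrow> a) (at \<xi> within stolz \<xi> t)"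
    using assms(2) by (simp add: nt_tendsto_def)
  moreover have "\<forall>\<^sub>F z in at \<xi> within stolz \<xi> t. f z = g z"
    using assms(1) by (auto simp: eventually_at_filter stolz_def)
  ultimately show "(g \<longlongrightarrow> a) (at \<xi> within stolz \<xi> t)"
    by (simp cong: filterlim_cong)
qed

text \<open>The derivative at \<open>z\<close> is controlled by Cauchy's inequality on the circle of radius
  \<open>(1 - \<bar>z\<bar>) / 2\<close>, which lies in a larger Stolz region.\<close>
lemma nt_tendsto_deriv:
  assumes hol: "\<phi> holomorphic_on ball 0 1"
    and lim: "nt_tendsto (\<lambda>z. \<phi> z / (z - \<xi>)) a \<xi>" and \<xi>: "\<xi> \<in> sphere 0 1"
  shows "nt_tendsto (deriv \<phi>) a \<xi>"
  unfolding nt_tendsto_def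
proof (intro allI impI)
  fix t :: real assume t: "t > 1"
  \<comment> \<open>Removing the linear part leaves \<psi> = o(|w - \<xi>|), with derivative
    \<open>deriv \<phi> z - a\<close>.\<close>
  define \<psi> where "\<psi> = (\<lambda>w. \<phi> w - a * (w - \<xi>))"
  have hol\<psi>: "\<psi> holomorphic_on ball 0 1"
    unfolding \<psi>_def by (intro holomorphic_intros hol)
  show "(deriv \<phi> \<longlongrightarrow> a) (at \<xi> within stolz \<xi> t)"
    unfolding tendsto_iff
  proof (intro allI impI)
    fix e :: real assume e: "e > 0"
    \<comment> \<open>On the circle of radius r about z one has |w - \<xi>| \<le> (2 t + 1) r, so
      Cauchy's inequality will give the bound \<epsilon> (2 t + 1) = e / 2.\<close>
    define \<epsilon> where "\<epsilon> = e / 2 / (2 * t + 1)"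
    have "\<epsilon> * (2 * t + 1) = e / 2" unfolding \<epsilon>_def using t by (intro nonzero_eq_divide_eq[THEN iffD1]) auto
    with e t have \<epsilon>: "\<epsilon> > 0" "\<epsilon> * (2 * t + 1) < e" by (auto simp: \<epsilon>_def)
    \<comment> \<open>On that circle also 1 - |w| \<ge> r, so the aperture 2 t + 2 contains
      it.\<close>
    have "((\<lambda>z. \<phi> z / (z - \<xi>)) \<longlongrightarrow> a) (at \<xi> within stolz \<xi> (2 * t + 2))"
      using lim t unfolding nt_tendsto_def by auto
    then obtain \<delta> where \<delta>: "\<delta> > 0" and close:
      "\<And>w. w \<in> stolz \<xi> (2 * t + 2) \<Longrightarrow> w \<noteq> \<xi> \<Longrightarrow> dist w \<xi> < \<delta> \<Longrightarrow> dist (\<phi> w / (w - \<xi>)) a < \<epsilon>"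
      using \<epsilon>(1) unfolding tendsto_iff eventually_at by blast
    have est: "cmod (\<psi> w) \<le> \<epsilon> * cmod (w - \<xi>)" if w: "w \<in> stolz \<xi> (2 * t + 2)" "dist w \<xi> < \<delta>" for w
    proof -
      have "w \<noteq> \<xi>" using w(1) \<xi> by (auto simp: stolz_def)
      then have "\<psi> w = (\<phi> w / (w - \<xi>) - a) * (w - \<xi>)"
        by (simp add: \<psi>_def field_simps)
      then have "cmod (\<psi> w) = dist (\<phi> w / (w - \<xi>)) a * cmod (w - \<xi>)"
        by (simp add: norm_mult dist_norm)
      also have "\<dots> \<le> \<epsilon> * cmod (w - \<xi>)"
        using close[OF w(1) \<open>w \<noteq> \<xi>\<close> w(2)] by (intro mult_right_mono) auto
      finally show ?thesis .
    qed
    have "dist (deriv \<phi> z) a < e" if z: "z \<in> stolz \<xi> t" "dist z \<xi> < \<delta> / 2" for z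
    proof -
      define r where "r = (1 - cmod z) / 2"
      have z1: "cmod z < 1" "cmod (z - \<xi>) < t * (1 - cmod z)" using z by (auto simp: stolz_def)
      then have r: "r > 0" by (simp add: r_def)
      \<comment> \<open>As 2 r = 1 - |z| is at most |z - \<xi>|, the restriction |z - \<xi>| <
        \<delta> / 2 keeps the circle within \<delta> of \<xi>.\<close>
      have r2: "2 * r \<le> cmod (z - \<xi>)"
        using \<xi> norm_triangle_ineq2[of \<xi> z] by (simp add: r_def norm_minus_commute)
      have ball: "cball z r \<subseteq> ball 0 1"
      proof
        fix w assume "w \<in> cball z r"
        then have "cmod (w - z) \<le> r" by (simp add: dist_norm norm_minus_commute)
        then show "w \<in> ball 0 1" using norm_triangle_sub[of w z] z1 by (simp add: r_def)
      qed
      have bnd: "cmod (\<psi> w) \<le> \<epsilon> * ((2 * t + 1) * r)" if w: "cmod (z - w) = r" for w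
      proof -
        have 1: "cmod (w - \<xi>) \<le> r + cmod (z - \<xi>)"
          using norm_triangle_ineq[of "w - z" "z - \<xi>"] w by (simp add: norm_minus_commute)
        have 2: "cmod w \<le> cmod z + r"
          using norm_triangle_sub[of w z] w by (simp add: norm_minus_commute)
        have 3: "cmod (w - \<xi>) \<le> (2 * t + 1) * r"
          using 1 z1 by (simp add: r_def field_simps)
        have "(2 * t + 1) * r < (2 * t + 2) * (1 - cmod w)"
        proof -
          have "(2 * t + 1) * r < (2 * t + 2) * r" using r by simp
          also have "\<dots> \<le> (2 * t + 2) * (1 - cmod w)"
            using 2 t by (intro mult_left_mono) (auto simp: r_def field_simps)
          finally show ?thesis .
        qed
        moreover have "cmod w < 1"
          using 2 z1 by (simp add: r_def field_simps)
        ultimately have "w \<in> stolz \<xi> (2 * t + 2)"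
          using 3 by (simp add: stolz_def)
        moreover have "dist w \<xi> < \<delta>"
          using 1 r2 z(2) \<delta> by (simp add: dist_norm)
        ultimately have "cmod (\<psi> w) \<le> \<epsilon> * cmod (w - \<xi>)"
          by (rule est)
        also have "\<dots> \<le> \<epsilon> * ((2 * t + 1) * r)"
          using 3 \<epsilon> by (intro mult_left_mono) auto
        finally show ?thesis .
      qed
      have "cmod ((deriv ^^ 1) \<psi> z) \<le> fact 1 * (\<epsilon> * ((2 * t + 1) * r)) / r ^ 1"
        using ball hol\<psi> r bnd
        by (intro Cauchy_inequality) (auto intro: holomorphic_on_subset holomorphic_on_imp_continuous_on
            dest: subset_trans[OF ball_subset_cball])
      then have "cmod (deriv \<psi> z) \<le> \<epsilon> * (2 * t + 1)" using r by simp
      moreover have "deriv \<psi> z = deriv \<phi> z - a"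
      proof (rule DERIV_imp_deriv)
        have "(\<phi> has_field_derivative deriv \<phi> z) (at z)"
          using hol z1 by (intro holomorphic_derivI[where S = "ball 0 1"]) auto
        then show "(\<psi> has_field_derivative deriv \<phi> z - a) (at z)"
          unfolding \<psi>_def by (auto intro!: derivative_eq_intros)
      qed
      ultimately show ?thesis using \<epsilon> by (simp add: dist_norm)
    qed
    then show "\<forall>\<^sub>F z in at \<xi> within stolz \<xi> t. dist (deriv \<phi> z) a < e"
      unfolding eventually_at using \<delta> by (intro exI[of _ "\<delta> / 2"]) auto
  qed
qed

section \<open>Derivatives of matrix-valued functions, entry by entry\<close>

lemma nt_tendsto_matrixI:
  assumes "\<And>i j. nt_tendsto (\<lambda>z. F z $ i $ j) (A $ i $ j) \<xi>"
  shows "nt_tendsto F A \<xi>"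
  using assms unfolding nt_tendsto_def by (intro allI impI vec_tendstoI) auto

lemma nt_tendsto_matrix_deriv:
  assumes "matrix_holomorphic_on G (ball 0 1)" "\<xi> \<in> sphere 0 1"
    and "nt_tendsto (\<lambda>z. cscale (1 / (z - \<xi>)) (G z)) A \<xi>"
  shows "nt_tendsto (matrix_deriv G) A \<xi>"
proof (rule nt_tendsto_matrixI)
  fix i j
  have "nt_tendsto (\<lambda>z. cscale (1 / (z - \<xi>)) (G z) $ i $ j) (A $ i $ j) \<xi>"
    using assms(3) unfolding nt_tendsto_def by (auto intro!: tendsto_vec_nth)
  then have "nt_tendsto (deriv (\<lambda>z. G z $ i $ j)) (A $ i $ j) \<xi>"
    using assms(1,2) by (intro nt_tendsto_deriv) (auto simp: cscale_def matrix_holomorphic_on_def)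
  then show "nt_tendsto (\<lambda>z. matrix_deriv G z $ i $ j) (A $ i $ j) \<xi>"
    by (simp add: matrix_deriv_def)
qed

lemma matrix_holomorphic_const_mult:
  assumes "matrix_holomorphic_on f S"
  shows "matrix_holomorphic_on (\<lambda>z. A ** f z) S" "matrix_holomorphic_on (\<lambda>z. f z ** A) S"
  using assms unfolding matrix_holomorphic_on_def matrix_matrix_mult_nth
  by (auto intro!: holomorphic_intros)

lemma matrix_holomorphic_diff_const:
  "matrix_holomorphic_on f S \<Longrightarrow> matrix_holomorphic_on (\<lambda>z. f z - A) S"
  unfolding matrix_holomorphic_on_def by (auto intro!: holomorphic_intros)

lemma matrix_deriv_affine:
  assumes f: "matrix_holomorphic_on f S" and S: "open S" "z \<in> S"
  shows "matrix_deriv (\<lambda>z. A ** f z ** B - C) z = A ** matrix_deriv f z ** B"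
proof -
  have "((\<lambda>w. f w $ i $ j) has_field_derivative matrix_deriv f z $ i $ j) (at z)" for i j
    using f S unfolding matrix_deriv_def matrix_holomorphic_on_def
    by (auto intro: holomorphic_derivI)
  then have "((\<lambda>w. (A ** f w ** B - C) $ i $ j) has_field_derivative (A ** matrix_deriv f z ** B) $ i $ j) (at z)"
    for i j
    by (auto simp: matrix_matrix_mult_nth mult.commute intro!: derivative_eq_intros sum.cong)
  then show ?thesis
    by (subst matrix_deriv_def) (auto simp: vec_eq_iff intro!: DERIV_imp_deriv)
qed

section \<open>The Herglotz kernel off a point of the circle\<close>

definition herglotz :: "complex \<Rightarrow> complex \<Rightarrow> complex" where
  "herglotz z \<zeta> = (\<zeta> + z) / (\<zeta> - z)"

definition poisson :: "complex \<Rightarrow> complex \<Rightarrow> real" where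
  "poisson z \<zeta> = (1 - (cmod z)\<^sup>2) / (cmod (\<zeta> - z))\<^sup>2"

lemma Re_herglotz:
  assumes "\<zeta> \<in> sphere 0 1"
  shows "Re (herglotz z \<zeta>) = poisson z \<zeta>"
proof -
  have "(cmod \<zeta>)\<^sup>2 = 1" using assms by simp
  then have "Re \<zeta> * Re \<zeta> + Im \<zeta> * Im \<zeta> = 1"
    unfolding cmod_power2 by (simp add: power2_eq_square)
  then show ?thesis
    unfolding herglotz_def poisson_def Re_divide cmod_power2
    by (simp add: power2_eq_square algebra_simps)
qed

lemma poisson_nonneg: "z \<in> ball 0 1 \<Longrightarrow> 0 \<le> poisson z \<zeta>"
  by (simp add: poisson_def abs_square_le_1)

lemma poisson_pos: "z \<in> ball 0 1 \<Longrightarrow> \<zeta> \<in> sphere 0 1 \<Longrightarrow> 0 < poisson z \<zeta>"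
  by (auto simp: poisson_def abs_square_less_1 intro!: divide_pos_pos)

lemma bounded_borel_herglotz:
  assumes "z \<in> ball 0 1"
  shows "bounded_borel (herglotz z)"
  unfolding herglotz_def using assms by (intro bounded_borel_continuous continuous_intros) auto

lemma bounded_borel_poisson:
  assumes "z \<in> ball 0 1"
  shows "bounded_borel (\<lambda>\<zeta>. complex_of_real (poisson z \<zeta>))"
  unfolding poisson_def using assms by (intro bounded_borel_continuous continuous_intros) auto

text \<open>Quantifies nontangential approach: \<open>1 / poisson z \<xi>\<close> is comparable to \<open>\<bar>\<xi> - z\<bar>\<close>.\<close>
lemma inverse_poisson_stolz:
  assumes z: "z \<in> stolz \<xi> t" and t: "t > 1"
  shows "1 / poisson z \<xi> \<le> t * cmod (\<xi> - z)" "cmod (\<xi> - z) \<le> t * (1 - (cmod z)\<^sup>2)"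
proof -
  have z1: "cmod z < 1" "cmod (\<xi> - z) < t * (1 - cmod z)"
    using z by (auto simp: stolz_def norm_minus_commute)
  have "(cmod z)\<^sup>2 \<le> cmod z" using z1 by (simp add: power2_eq_square mult_left_le)
  then have "t * (1 - cmod z) \<le> t * (1 - (cmod z)\<^sup>2)" using t by simp
  with z1 show *: "cmod (\<xi> - z) \<le> t * (1 - (cmod z)\<^sup>2)" by linarith
  have pos: "1 - (cmod z)\<^sup>2 > 0" using z1 by (simp add: abs_square_less_1)
  have "cmod (\<xi> - z) * cmod (\<xi> - z) \<le> t * (1 - (cmod z)\<^sup>2) * cmod (\<xi> - z)"
    using * by (rule mult_right_mono) simp
  then show "1 / poisson z \<xi> \<le> t * cmod (\<xi> - z)"
    using pos by (simp add: poisson_def power2_eq_square field_simps)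
qed

text \<open>Removes the atom at \<xi> from an integral while keeping the measure \<mu>. The value
  type is open because both the complex Herglotz kernel and the real Poisson kernel are treated this
  way.\<close>

definition off_point :: "complex \<Rightarrow> (complex \<Rightarrow> 'a :: zero) \<Rightarrow> complex \<Rightarrow> 'a" where
  "off_point \<xi> f \<zeta> = (if \<zeta> = \<xi> then 0 else f \<zeta>)"

lemma singleton_sets_circle_borel: "\<xi> \<in> sphere 0 1 \<Longrightarrow> {\<xi>} \<in> sets circle_borel"
  by (auto simp: sets_restrict_space intro!: image_eqI[of _ _ "{\<xi>}"])

lemma bounded_borel_off_point:
  assumes \<xi>: "\<xi> \<in> sphere 0 1" and f: "bounded_borel f"
  shows "bounded_borel (off_point \<xi> f)"
proof -
  have ind: "bounded_borel (indicator {\<xi>})"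
    using singleton_sets_circle_borel[OF \<xi>]
    by (intro bounded_borelI[where B = 1]) (auto simp: indicator_def)
  have "off_point \<xi> f = (\<lambda>\<zeta>. f \<zeta> + (- f \<xi>) * indicator {\<xi>} \<zeta>)"
    by (auto simp: off_point_def indicator_def)
  with f ind show ?thesis
    by (simp only: bounded_borel_add bounded_borel_mult bounded_borel_const)
qed

lemma bounded_borel_off_point_poisson:
  assumes "\<xi> \<in> sphere 0 1" "z \<in> ball 0 1"
  shows "bounded_borel (\<lambda>\<zeta>. complex_of_real (off_point \<xi> (poisson z) \<zeta>))"
proof -
  have "(\<lambda>\<zeta>. complex_of_real (off_point \<xi> (poisson z) \<zeta>)) = off_point \<xi> (\<lambda>\<zeta>. complex_of_real (poisson z \<zeta>))"
    by (auto simp: off_point_def)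
  then show ?thesis
    using bounded_borel_off_point[OF assms(1) bounded_borel_poisson[OF assms(2)]] by simp
qed

text \<open>Adding 1 to the Poisson kernel turns the weighted kernel into |\<zeta> + z|^2 / q with q
  = (1 - |z|^2) + |\<zeta> - z|^2, and \<open>inverse_poisson_stolz\<close> supplies a factor t
  |\<xi> - z|. Bounding q below by its first summand gives the uniform bound for dominated
  convergence; by its second, the pointwise limit 0 as z tends to \<xi>.\<close>

lemma weighted_kernel_bound:
  assumes z: "z \<in> stolz \<xi> t" and t: "t > 1" and \<xi>: "\<xi> \<in> sphere 0 1" and \<zeta>: "\<zeta> \<in> sphere 0 1" "\<zeta> \<noteq> \<xi>"
  defines "\<phi> \<equiv> (cmod (herglotz z \<zeta>))\<^sup>2 / (poisson z \<zeta> + 1) / poisson z \<xi>"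
  shows "\<phi> \<le> 4 * t\<^sup>2" "\<phi> \<le> 4 * t * cmod (\<xi> - z) / (cmod (\<zeta> - z))\<^sup>2" "0 \<le> \<phi>"
proof -
  have z1: "z \<in> ball 0 1" using z by (auto simp: stolz_def)
  have pos: "1 - (cmod z)\<^sup>2 > 0" using z1 by (simp add: abs_square_less_1)
  have d: "cmod (\<zeta> - z) > 0" using z1 \<zeta> by auto
  have p0: "poisson z \<zeta> \<ge> 0" "poisson z \<xi> > 0" using poisson_nonneg poisson_pos z1 \<xi> by auto
  have sq: "(cmod (\<zeta> + z))\<^sup>2 \<le> 4"
    using norm_triangle_ineq[of \<zeta> z] z1 \<zeta> power_mono[of "cmod (\<zeta> + z)" 2 2] by simp
  define q where "q = (1 - (cmod z)\<^sup>2) + (cmod (\<zeta> - z))\<^sup>2"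
  have q: "q > 0" using pos by (simp add: q_def add_pos_nonneg)
  have "(cmod (herglotz z \<zeta>))\<^sup>2 / (poisson z \<zeta> + 1) = (cmod (\<zeta> + z))\<^sup>2 / q"
    using d q by (simp add: herglotz_def poisson_def q_def norm_divide power_divide divide_simps)
  also have "\<dots> \<le> 4 / q"
    using sq q by (intro divide_right_mono) auto
  finally have "\<phi> \<le> 4 / q / poisson z \<xi>"
    unfolding \<phi>_def using p0 by (intro divide_right_mono) auto
  also have "\<dots> = 4 / q * (1 / poisson z \<xi>)" by simp
  also have "\<dots> \<le> 4 / q * (t * cmod (\<xi> - z))"
    using inverse_poisson_stolz[OF z t] q by (intro mult_left_mono) auto
  finally have main: "\<phi> \<le> 4 * t * cmod (\<xi> - z) / q" by simp
  also have "\<dots> \<le> 4 * t * cmod (\<xi> - z) / (cmod (\<zeta> - z))\<^sup>2"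
    using pos d t by (intro divide_left_mono) (auto simp: q_def intro!: mult_pos_pos add_pos_pos)
  finally show "\<phi> \<le> 4 * t * cmod (\<xi> - z) / (cmod (\<zeta> - z))\<^sup>2" .
  have "4 * t * cmod (\<xi> - z) / q \<le> 4 * t * cmod (\<xi> - z) / (1 - (cmod z)\<^sup>2)"
    using pos d t by (intro divide_left_mono) (auto simp: q_def intro!: mult_pos_pos add_pos_pos)
  also have "\<dots> \<le> 4 * t * t"
  proof -
    have "4 * t * cmod (\<xi> - z) \<le> 4 * t * (t * (1 - (cmod z)\<^sup>2))"
      using inverse_poisson_stolz(2)[OF z t] t by (intro mult_left_mono) auto
    then show ?thesis using pos by (simp add: divide_simps mult_ac)
  qed
  finally show "\<phi> \<le> 4 * t\<^sup>2" using main by (simp add: power2_eq_square)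
  show "0 \<le> \<phi>" using p0 by (simp add: \<phi>_def)
qed

section \<open>Integrals of the kernels, with the mass at a point split off\<close>

context nonneg_matrix_measure_space
begin

text \<open>The imaginary part of f contributes \<i> times a real number. To see that it is real, Im
  f is shifted by a bound B: the integrals of Im f + B and of 1 both have non-negative
  forms.\<close>

lemma Re_cinner_matrix_integral:
  assumes f: "bounded_borel f"
  shows "Re (cinner (matrix_integral \<mu> f *v x) x) =
    Re (cinner (matrix_integral \<mu> (\<lambda>\<zeta>. complex_of_real (Re (f \<zeta>))) *v x) x)"
proof -
  obtain B where B: "\<forall>\<zeta>\<in>sphere 0 1. cmod (f \<zeta>) \<le> B"
    using f unfolding bounded_borel_def by blast
  have bre: "bounded_borel (\<lambda>\<zeta>. complex_of_real (Re (f \<zeta>)))"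
    using B bounded_borel_measurable[OF f]
    by (intro bounded_borelI[where B = B]) (auto intro: order_trans[OF abs_Re_le_cmod])
  have bim: "bounded_borel (\<lambda>\<zeta>. complex_of_real (Im (f \<zeta>)))"
    using B bounded_borel_measurable[OF f]
    by (intro bounded_borelI[where B = B]) (auto intro: order_trans[OF abs_Im_le_cmod])
  have nn: "nonneg_matrix (matrix_integral \<mu> (\<lambda>\<zeta>. complex_of_real (Im (f \<zeta>) + B)))"
  proof (rule nonneg_matrix_integral)
    show "bounded_borel (\<lambda>\<zeta>. complex_of_real (Im (f \<zeta>) + B))"
      using bounded_borel_add[OF bim bounded_borel_const[of "complex_of_real B"]] by simp
    show "0 \<le> Im (f \<zeta>) + B" if "\<zeta> \<in> sphere 0 1" for \<zeta>
      using B[rule_format, OF that] abs_Im_le_cmod[of "f \<zeta>"] by linarith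
  qed
  have nn1: "nonneg_matrix (matrix_integral \<mu> (\<lambda>\<zeta>. complex_of_real 1))"
    by (rule nonneg_matrix_integral) auto
  have "cinner (matrix_integral \<mu> (\<lambda>\<zeta>. complex_of_real (Im (f \<zeta>) + B)) *v x) x =
      cinner (matrix_integral \<mu> (\<lambda>\<zeta>. complex_of_real (Im (f \<zeta>))) *v x) x +
      complex_of_real B * cinner (matrix_integral \<mu> (\<lambda>\<zeta>. complex_of_real 1) *v x) x"
    using cinner_matrix_integral_linear[OF bounded_borel_const[of 1] bim, of "complex_of_real B"]
    by (simp add: add.commute)
  then have im: "Im (cinner (matrix_integral \<mu> (\<lambda>\<zeta>. complex_of_real (Im (f \<zeta>))) *v x) x) = 0"
    using nn nn1 unfolding nonneg_matrix_def complex_nonneg_Reals_iff by (simp add: complex_eq_iff)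
  have "matrix_integral \<mu> f = matrix_integral \<mu> (\<lambda>\<zeta>. \<i> * complex_of_real (Im (f \<zeta>)) + complex_of_real (Re (f \<zeta>)))"
    by (intro matrix_integral_cong) (simp add: complex_eq_iff)
  then show ?thesis
    using cinner_matrix_integral_linear[OF bim bre, of \<i> x x] im by simp
qed

lemma matrix_integral_split_point:
  assumes f: "bounded_borel f" and \<xi>: "\<xi> \<in> sphere 0 1"
  shows "matrix_integral \<mu> f = cscale (f \<xi>) (\<mu> {\<xi>}) + matrix_integral \<mu> (off_point \<xi> f)"
proof -
  have "matrix_integral \<mu> f = matrix_integral \<mu> (\<lambda>\<zeta>. f \<xi> * indicator {\<xi>} \<zeta> + off_point \<xi> f \<zeta>)"
    by (intro matrix_integral_cong) (auto simp: off_point_def indicator_def)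
  also have "\<dots> = cscale (f \<xi>) (matrix_integral \<mu> (indicator {\<xi>})) + matrix_integral \<mu> (off_point \<xi> f)"
    by (intro matrix_integral_linear bounded_borel_indicator singleton_sets_circle_borel \<xi>
        bounded_borel_off_point f)
  finally show ?thesis
    by (simp add: matrix_integral_indicator[OF nonneg_measure singleton_sets_circle_borel[OF \<xi>]])
qed

lemma nonneg_matrix_point: "\<xi> \<in> sphere 0 1 \<Longrightarrow> nonneg_matrix (\<mu> {\<xi>})"
  using nonneg_measure singleton_sets_circle_borel unfolding nonneg_matrix_measure_def by blast

lemma nonneg_matrix_off_point_poisson:
  "\<xi> \<in> sphere 0 1 \<Longrightarrow> z \<in> ball 0 1 \<Longrightarrow>
    nonneg_matrix (matrix_integral \<mu> (\<lambda>\<zeta>. complex_of_real (off_point \<xi> (poisson z) \<zeta>)))"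
  by (rule nonneg_matrix_integral[OF bounded_borel_off_point_poisson])
     (auto simp: off_point_def intro: poisson_nonneg)

lemma Re_cinner_herglotz_integral:
  assumes z: "z \<in> ball 0 1" and \<xi>: "\<xi> \<in> sphere 0 1"
  shows "Re (cinner (matrix_integral \<mu> (herglotz z) *v x) x) =
    poisson z \<xi> * Re (cinner (\<mu> {\<xi>} *v x) x) +
    Re (cinner (matrix_integral \<mu> (\<lambda>\<zeta>. complex_of_real (off_point \<xi> (poisson z) \<zeta>)) *v x) x)"
proof -
  have "Re (cinner (matrix_integral \<mu> (herglotz z) *v x) x) =
      Re (cinner (matrix_integral \<mu> (\<lambda>\<zeta>. complex_of_real (Re (herglotz z \<zeta>))) *v x) x)"
    by (rule Re_cinner_matrix_integral[OF bounded_borel_herglotz[OF z]])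
  also have "matrix_integral \<mu> (\<lambda>\<zeta>. complex_of_real (Re (herglotz z \<zeta>))) =
      matrix_integral \<mu> (\<lambda>\<zeta>. complex_of_real (poisson z \<zeta>))"
    by (intro matrix_integral_cong) (simp add: Re_herglotz)
  also have "\<dots> = cscale (complex_of_real (poisson z \<xi>)) (\<mu> {\<xi>}) +
      matrix_integral \<mu> (off_point \<xi> (\<lambda>\<zeta>. complex_of_real (poisson z \<zeta>)))"
    by (rule matrix_integral_split_point[OF bounded_borel_poisson[OF z] \<xi>])
  also have "off_point \<xi> (\<lambda>\<zeta>. complex_of_real (poisson z \<zeta>)) =
      (\<lambda>\<zeta>. complex_of_real (off_point \<xi> (poisson z) \<zeta>))"
    by (auto simp: off_point_def)
  finally show ?thesis
    by (simp add: matrix_vector_mult_add_rdistrib cinner_add_left cscale_mult_vec cinner_scale_left)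
qed

text \<open>The kernel is factored as \<open>k = (k / sqrt (p + 1)) sqrt (p + 1)\<close>, \<open>p\<close> being the Poisson kernel
  off \<open>\<xi>\<close>. By the Cauchy--Schwarz inequality, the hypothesis on \<open>y\<close> takes care of the second factor,
  and dominated convergence of the first one.\<close>
lemma tendsto_off_point_herglotz:
  assumes \<xi>: "\<xi> \<in> sphere 0 1" and t: "t > 1" and z: "\<And>k. z k \<in> stolz \<xi> t" and lim: "z \<longlonglongrightarrow> \<xi>"
    and y: "\<And>k. (norm (y k))\<^sup>2 +
      Re (cinner (matrix_integral \<mu> (\<lambda>\<zeta>. complex_of_real (off_point \<xi> (poisson (z k)) \<zeta>)) *v y k) (y k))
      \<le> C / poisson (z k) \<xi>"
  shows "(\<lambda>k. cinner (matrix_integral \<mu> (off_point \<xi> (herglotz (z k))) *v w) (y k)) \<longlonglongrightarrow> 0"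
proof -
  have zb: "z k \<in> ball 0 1" for k using z[of k] by (auto simp: stolz_def)
  define p where "p = (\<lambda>k. off_point \<xi> (poisson (z k)))"
  have p0: "p k \<zeta> \<ge> 0" for k \<zeta> using poisson_nonneg[OF zb] by (simp add: p_def off_point_def)
  have bp: "bounded_borel (\<lambda>\<zeta>. complex_of_real (p k \<zeta>))" for k
    unfolding p_def by (rule bounded_borel_off_point_poisson[OF \<xi> zb])
  define h where "h = (\<lambda>k \<zeta>. complex_of_real (sqrt (p k \<zeta> + 1)))"
  define g where "g = (\<lambda>k \<zeta>. off_point \<xi> (herglotz (z k)) \<zeta> * complex_of_real (1 / sqrt (p k \<zeta> + 1)))"
  have mp: "p k \<in> borel_measurable circle_borel" for k
    using measurable_compose[OF bounded_borel_measurable[OF bp[of k]] borel_measurable_Re] by simp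
  have bh: "bounded_borel (h k)" for k
  proof -
    obtain B where B: "\<forall>\<zeta>\<in>sphere 0 1. cmod (complex_of_real (p k \<zeta>)) \<le> B"
      using bp[of k] unfolding bounded_borel_def by blast
    show ?thesis
      unfolding h_def
    proof (rule bounded_borelI[where B = "sqrt (B + 1)"])
      show "cmod (complex_of_real (sqrt (p k \<zeta> + 1))) \<le> sqrt (B + 1)" if "\<zeta> \<in> sphere 0 1" for \<zeta>
        using B[rule_format, OF that] p0[of k \<zeta>] by simp
    qed (use mp[of k] in measurable)
  qed
  have bg: "bounded_borel (g k)" for k
    unfolding g_def
  proof (intro bounded_borel_mult bounded_borel_off_point[OF \<xi>] bounded_borel_herglotz zb)
    show "bounded_borel (\<lambda>\<zeta>. complex_of_real (1 / sqrt (p k \<zeta> + 1)))"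
    proof (rule bounded_borelI[where B = 1])
      show "cmod (complex_of_real (1 / sqrt (p k \<zeta> + 1))) \<le> 1" for \<zeta>
        using p0[of k \<zeta>] by (simp add: norm_divide)
    qed (use mp[of k] in measurable)
  qed
  \<comment> \<open>The hypothesis on y bounds the second Cauchy-Schwarz factor by a multiple of 1 /
    \<open>poisson (z k) \<xi>\<close>. Here that quantity is moved into the first factor, where
    \<open>weighted_kernel_bound\<close> dominates it.\<close>
  define \<phi> where "\<phi> = (\<lambda>k \<zeta>. complex_of_real (1 / poisson (z k) \<xi>) * (g k \<zeta> * cnj (g k \<zeta>)))"
  have b\<phi>: "bounded_borel (\<phi> k)" for k
    unfolding \<phi>_def by (intro bounded_borel_mult bounded_borel_const bg bounded_borel_cnj)
  have \<phi>_eq: "cmod (\<phi> k \<zeta>) = (if \<zeta> = \<xi> then 0 else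
      (cmod (herglotz (z k) \<zeta>))\<^sup>2 / (poisson (z k) \<zeta> + 1) / poisson (z k) \<xi>)" for k \<zeta>
    using poisson_nonneg[OF zb[of k]]
    by (simp add: \<phi>_def g_def p_def off_point_def norm_mult norm_divide power2_eq_square)
  have lim\<phi>: "(\<lambda>k. cinner (matrix_integral \<mu> (\<phi> k) *v w) w) \<longlonglongrightarrow> cinner (matrix_integral \<mu> (\<lambda>\<zeta>. 0) *v w) w"
  proof (rule tendsto_cinner_matrix_integral[where B = "4 * t\<^sup>2"])
    fix \<zeta> :: complex assume \<zeta>: "\<zeta> \<in> sphere 0 1"
    show "cmod (\<phi> k \<zeta>) \<le> 4 * t\<^sup>2" for k
      using weighted_kernel_bound(1)[OF z t \<xi> \<zeta>] by (auto simp: \<phi>_eq)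
    show "(\<lambda>k. \<phi> k \<zeta>) \<longlonglongrightarrow> 0"
    proof (cases "\<zeta> = \<xi>")
      case True
      then show ?thesis by (simp add: \<phi>_def g_def off_point_def)
    next
      case False
      have "(\<lambda>k. 4 * t * cmod (\<xi> - z k) / (cmod (\<zeta> - z k))\<^sup>2) \<longlonglongrightarrow> 4 * t * cmod (\<xi> - \<xi>) / (cmod (\<zeta> - \<xi>))\<^sup>2"
        using False by (intro tendsto_intros lim) auto
      then have "(\<lambda>k. 4 * t * cmod (\<xi> - z k) / (cmod (\<zeta> - z k))\<^sup>2) \<longlonglongrightarrow> 0" by simp
      then show ?thesis
        by (rule Lim_null_comparison[rotated])
           (use weighted_kernel_bound(2)[OF z t \<xi> \<zeta> False] False in \<open>auto simp: \<phi>_eq\<close>)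
    qed
  qed (use b\<phi> in auto)
  \<comment> \<open>K is the norm of the total mass of \<mu>; it pays for the summand 1 in the
    weight p + 1.\<close>
  define K where "K = onorm ((*v) (matrix_integral \<mu> (\<lambda>\<zeta>. 1)))"
  have K0: "K \<ge> 0" unfolding K_def by (intro onorm_pos_le bounded_linear_matrix_vector)
  have est: "(cmod (cinner (matrix_integral \<mu> (off_point \<xi> (herglotz (z k))) *v w) (y k)))\<^sup>2 \<le>
      (1 + K) * C * Re (cinner (matrix_integral \<mu> (\<phi> k) *v w) w)" for k
  proof -
    have q: "poisson (z k) \<xi> > 0" by (rule poisson_pos[OF zb \<xi>])
    have gh: "g k \<zeta> * cnj (h k \<zeta>) = off_point \<xi> (herglotz (z k)) \<zeta>" for \<zeta>
      using p0[of k \<zeta>] by (simp add: g_def h_def)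
    have hh: "h k \<zeta> * cnj (h k \<zeta>) = 1 * complex_of_real (p k \<zeta>) + 1" for \<zeta>
      using p0[of k \<zeta>] by (simp add: h_def flip: of_real_mult)
    define N where "N = Re (cinner (matrix_integral \<mu> (\<lambda>\<zeta>. complex_of_real (p k \<zeta>)) *v y k) (y k))"
    have N0: "N \<ge> 0"
      unfolding N_def p_def by (intro nonneg_matrix_Re nonneg_matrix_off_point_poisson \<xi> zb)
    have "Re (cinner (matrix_integral \<mu> (\<lambda>\<zeta>. h k \<zeta> * cnj (h k \<zeta>)) *v y k) (y k)) =
        N + Re (cinner (matrix_integral \<mu> (\<lambda>\<zeta>. 1) *v y k) (y k))"
      unfolding hh cinner_matrix_integral_linear[OF bp bounded_borel_const] N_def by simp
    also have "Re (cinner (matrix_integral \<mu> (\<lambda>\<zeta>. 1) *v y k) (y k)) \<le> K * (norm (y k))\<^sup>2"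
      using order_trans[OF complex_Re_le_cmod cmod_cinner_matrix_le[of "matrix_integral \<mu> (\<lambda>\<zeta>. 1)" "y k" "y k"]]
      by (simp add: K_def power2_eq_square mult_ac)
    also have "N + K * (norm (y k))\<^sup>2 \<le> (1 + K) * ((norm (y k))\<^sup>2 + N)"
      using K0 N0 by (simp add: algebra_simps)
    also have "\<dots> \<le> (1 + K) * (C / poisson (z k) \<xi>)"
      using y[of k] K0 unfolding N_def p_def by (intro mult_left_mono) auto
    finally have hb: "Re (cinner (matrix_integral \<mu> (\<lambda>\<zeta>. h k \<zeta> * cnj (h k \<zeta>)) *v y k) (y k)) \<le>
        (1 + K) * (C / poisson (z k) \<xi>)" by simp
    define a where "a = Re (cinner (matrix_integral \<mu> (\<lambda>\<zeta>. g k \<zeta> * cnj (g k \<zeta>)) *v w) w)"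
    have a0: "a \<ge> 0"
      using matrix_integral_norm_sq_nonneg[OF bg] unfolding a_def by (simp add: complex_nonneg_Reals_iff)
    have \<phi>a: "Re (cinner (matrix_integral \<mu> (\<phi> k) *v w) w) = 1 / poisson (z k) \<xi> * a"
      unfolding \<phi>_def a_def matrix_integral_scale[OF bounded_borel_mult[OF bg bounded_borel_cnj[OF bg]]]
      by (simp add: cscale_mult_vec cinner_scale_left)
    have "(cmod (cinner (matrix_integral \<mu> (\<lambda>\<zeta>. g k \<zeta> * cnj (h k \<zeta>)) *v w) (y k)))\<^sup>2 \<le>
        a * Re (cinner (matrix_integral \<mu> (\<lambda>\<zeta>. h k \<zeta> * cnj (h k \<zeta>)) *v y k) (y k))"
      unfolding a_def by (rule matrix_integral_cauchy_schwarz[OF bg bh])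
    also have "\<dots> \<le> a * ((1 + K) * (C / poisson (z k) \<xi>))"
      using hb a0 by (rule mult_left_mono)
    finally show ?thesis
      unfolding gh \<phi>a by (simp add: mult_ac)
  qed
  have "(\<lambda>k. (1 + K) * C * Re (cinner (matrix_integral \<mu> (\<phi> k) *v w) w)) \<longlonglongrightarrow> 0"
    using tendsto_mult_right_zero[OF tendsto_Re[OF lim\<phi>, simplified]] by simp
  then have "(\<lambda>k. (cmod (cinner (matrix_integral \<mu> (off_point \<xi> (herglotz (z k))) *v w) (y k)))\<^sup>2) \<longlonglongrightarrow> 0"
    by (rule Lim_null_comparison[rotated]) (use est in simp)
  then have "(\<lambda>k. cmod (cinner (matrix_integral \<mu> (off_point \<xi> (herglotz (z k))) *v w) (y k))) \<longlonglongrightarrow> 0"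
    by (simp add: tendsto_null_power)
  then show ?thesis by (simp add: tendsto_norm_zero_iff)
qed

end

section \<open>Aleksandrov--Clark resolvents\<close>

lemma schur_class_mult_unitary:
  assumes b: "b \<in> schur_class" and \<alpha>: "unitary_matrix \<alpha>"
  shows "(\<lambda>z. b z ** mat_adj \<alpha>) \<in> schur_class"
proof -
  have iso: "norm (mat_adj \<alpha> *v v) = norm v" for v
  proof -
    have "cinner (mat_adj \<alpha> *v v) (mat_adj \<alpha> *v v) = cinner v v"
      unfolding cinner_mat_adj' using \<alpha> by (simp add: matrix_vector_mul_assoc unitary_matrix_def)
    then have "(norm (mat_adj \<alpha> *v v))\<^sup>2 = (norm v)\<^sup>2"
      unfolding cinner_self of_real_eq_iff .
    then show ?thesis by simp
  qed
  have "onorm ((*v) (b z ** mat_adj \<alpha>)) \<le> onorm ((*v) (b z))" for z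
  proof (rule onorm_bound)
    show "0 \<le> onorm ((*v) (b z))" by (rule onorm_pos_le[OF bounded_linear_matrix_vector])
    show "norm ((b z ** mat_adj \<alpha>) *v v) \<le> onorm ((*v) (b z)) * norm v" for v
      using onorm[OF bounded_linear_matrix_vector, of "b z" "mat_adj \<alpha> *v v"]
      by (simp add: iso matrix_vector_mul_assoc)
  qed
  then show ?thesis
    using b unfolding schur_class_def
    by (auto intro: matrix_holomorphic_const_mult order_le_less_trans)
qed

text \<open>A nonzero kernel vector would be a fixed vector of a strict contraction.\<close>

lemma invertible_one_minus_contraction:
  fixes F :: "complex ^ 'n ^ 'n"
  assumes "onorm ((*v) F) < 1"
  shows "invertible (mat 1 - F)"
  unfolding invertible_left_inverse matrix_left_invertible_ker
proof (intro allI impI, rule ccontr)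
  fix x assume x: "(mat 1 - F) *v x = 0" "x \<noteq> 0"
  then have "F *v x = x" by (simp add: matrix_vector_mult_diff_rdistrib)
  then have "norm x \<le> onorm ((*v) F) * norm x"
    using onorm[OF bounded_linear_matrix_vector, of F x] by simp
  then show False using x(2) assms by simp
qed

text \<open>With F = \<open>b z ** mat_adj \<alpha>\<close>, this is (I + F) + (I - F) = 2 I
  together with the fact that I + F and I - F commute. The first order serves J M; the second serves
  M J T and, through adjoints, the adjoint of J.\<close>

lemma AC_function_resolvent:
  assumes inv: "invertible (mat 1 - b z ** mat_adj \<alpha>)"
  shows "(AC_function b \<alpha> z + mat 1) ** (mat 1 - b z ** mat_adj \<alpha>) = cscale 2 (mat 1)"
    and "(mat 1 - b z ** mat_adj \<alpha>) ** (AC_function b \<alpha> z + mat 1) = cscale 2 (mat 1)"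
proof -
  define F where "F = b z ** mat_adj \<alpha>"
  define J where "J = mat 1 - F"
  define I where "I = matrix_inv J"
  \<comment> \<open>\<open>matrix_inv\<close> is a choice, so its two equations are extracted from
    existence.\<close>
  have "\<exists>I. J ** I = mat 1 \<and> I ** J = mat 1"
    using inv unfolding invertible_def J_def F_def .
  then have I: "J ** I = mat 1" "I ** J = mat 1"
    using someI_ex[of "\<lambda>I. J ** I = mat 1 \<and> I ** J = mat 1"] unfolding I_def matrix_inv_def by blast+
  have sum: "(mat 1 + F) + J = cscale 2 (mat 1)"
    by (auto simp: J_def vec_eq_iff cscale_def)
  have commute: "J ** (mat 1 + F) = (mat 1 + F) ** J"
    by (simp add: J_def matrix_add_ldistrib matrix_add_rdistrib matrix_diff_ldistrib matrix_diff_rdistrib)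
  have H: "AC_function b \<alpha> z = (mat 1 + F) ** I"
    by (simp add: AC_function_def I_def J_def F_def)
  have "(mat 1 + F) ** I ** J = mat 1 + F"
    by (simp add: matrix_mul_assoc[symmetric] I)
  then show "(AC_function b \<alpha> z + mat 1) ** (mat 1 - b z ** mat_adj \<alpha>) = cscale 2 (mat 1)"
    using sum by (simp add: H matrix_add_rdistrib F_def[symmetric] J_def[symmetric])
  have "J ** ((mat 1 + F) ** I) = mat 1 + F"
    unfolding matrix_mul_assoc commute by (simp add: matrix_mul_assoc[symmetric] I)
  then show "(mat 1 - b z ** mat_adj \<alpha>) ** (AC_function b \<alpha> z + mat 1) = cscale 2 (mat 1)"
    using sum by (simp add: H matrix_add_ldistrib F_def[symmetric] J_def[symmetric])
qed

text \<open>Isolates what the estimates use: the Herglotz representation of H, and J = 2 (H + I)^-1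
  as a two-sided identity.\<close>

locale clark_resolvent = nonneg_matrix_measure_space \<mu>
  for \<mu> :: "complex set \<Rightarrow> complex ^ 'n ^ 'n" +
  fixes H J :: "complex \<Rightarrow> complex ^ 'n ^ 'n" and \<xi> :: complex
  assumes \<xi>: "\<xi> \<in> sphere 0 1"
    and herglotz_representation:
      "z \<in> ball 0 1 \<Longrightarrow> H z = cscale \<i> (im_part (H 0)) + matrix_integral \<mu> (herglotz z)"
    and HJ: "z \<in> ball 0 1 \<Longrightarrow> (H z + mat 1) ** J z = cscale 2 (mat 1)"
    and JH: "z \<in> ball 0 1 \<Longrightarrow> J z ** (H z + mat 1) = cscale 2 (mat 1)"
begin

abbreviation "M \<equiv> \<mu> {\<xi>}"

abbreviation off_mass :: "complex \<Rightarrow> complex ^ 'n \<Rightarrow> real" where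
  "off_mass z x \<equiv>
     Re (cinner (matrix_integral \<mu> (\<lambda>\<zeta>. complex_of_real (off_point \<xi> (poisson z) \<zeta>)) *v x) x)"

lemma M_adj: "mat_adj M = M"
  by (rule nonneg_matrix_hermitian[OF nonneg_matrix_point[OF \<xi>]])

lemma Re_cinner_H:
  assumes z: "z \<in> ball 0 1"
  shows "Re (cinner ((H z + mat 1) *v x) x) =
    (norm x)\<^sup>2 + poisson z \<xi> * Re (cinner (M *v x) x) + off_mass z x"
proof -
  have "Re (cinner ((H z + mat 1) *v x) x) =
      Re (cinner (cscale \<i> (im_part (H 0)) *v x) x) + Re (cinner (matrix_integral \<mu> (herglotz z) *v x) x)
      + Re (cinner x x)"
    unfolding herglotz_representation[OF z]
    by (simp add: matrix_vector_mult_add_rdistrib cinner_add_left)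
  also have "Re (cinner x x) = (norm x)\<^sup>2"
    unfolding cinner_self by simp
  finally show ?thesis
    unfolding Re_cinner_im_part Re_cinner_herglotz_integral[OF z \<xi>] by simp
qed

text \<open>Pairing with x gives 2 Re <M w, x> on one side and \<open>Re_cinner_H\<close> on the
  other; \<open>nonneg_matrix_young\<close> with p = \<open>poisson z \<xi>\<close> cancels the
  terms p <M x, x>. An adjoint has the same real part, so both equations are treated at once. The
  summand \<open>off_mass\<close> is kept for \<open>tendsto_off_point_herglotz\<close>.\<close>

lemma resolvent_bound:
  assumes z: "z \<in> ball 0 1"
    and eq: "(H z + mat 1) *v x = 2 *s (M *v w) \<or> mat_adj (H z + mat 1) *v x = 2 *s (M *v w)"
  shows "(norm x)\<^sup>2 + off_mass z x \<le> Re (cinner (M *v w) w) / poisson z \<xi>"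
proof -
  have "2 * Re (cinner (M *v w) x) = Re (cinner ((H z + mat 1) *v x) x)"
    using eq Re_cinner_mat_adj[of "H z + mat 1" x] by (auto simp: cinner_scale_left)
  with nonneg_matrix_young[OF nonneg_matrix_point[OF \<xi>] poisson_pos[OF z \<xi>], of w x]
  show ?thesis unfolding Re_cinner_H[OF z] by simp
qed

lemma resolvent_point_bound:
  assumes "z \<in> ball 0 1"
  shows "(norm (J z *v (M *v w)))\<^sup>2 + off_mass z (J z *v (M *v w)) \<le> Re (cinner (M *v w) w) / poisson z \<xi>"
  by (rule resolvent_bound[OF assms])
     (simp add: matrix_vector_mul_assoc matrix_mul_assoc HJ[OF assms] cscale_mult_left flip: cscale_mult_vec)

lemma adjoint_resolvent_point_bound:
  assumes "z \<in> ball 0 1"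
  shows "(norm (mat_adj (J z) *v (M *v w)))\<^sup>2 + off_mass z (mat_adj (J z) *v (M *v w))
    \<le> Re (cinner (M *v w) w) / poisson z \<xi>"
proof (rule resolvent_bound[OF assms])
  have "mat_adj (H z + mat 1) ** mat_adj (J z) = cscale 2 (mat 1)"
    unfolding mat_adj_mult[symmetric] JH[OF assms] mat_adj_cscale by simp
  then have "mat_adj (H z + mat 1) *v (mat_adj (J z) *v (M *v w)) = cscale 2 (mat 1) *v (M *v w)"
    by (simp only: matrix_vector_mul_assoc matrix_mul_assoc)
  then show "(H z + mat 1) *v (mat_adj (J z) *v (M *v w)) = 2 *s (M *v w) \<or>
      mat_adj (H z + mat 1) *v (mat_adj (J z) *v (M *v w)) = 2 *s (M *v w)"
    by (simp add: cscale_mult_vec)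
qed

lemma tendsto_zero_if_poisson_bound:
  assumes t: "t > 1" and z: "\<And>k. z k \<in> stolz \<xi> t" and lim: "z \<longlonglongrightarrow> \<xi>"
    and y: "\<And>k. (norm (y k))\<^sup>2 + off_mass (z k) (y k) \<le> C / poisson (z k) \<xi>" and C: "C \<ge> 0"
  shows "y \<longlonglongrightarrow> (0 :: complex ^ 'n)"
proof -
  have zb: "z k \<in> ball 0 1" for k using z[of k] by (auto simp: stolz_def)
  have "(norm (y k))\<^sup>2 \<le> C * (t * cmod (\<xi> - z k))" for k
  proof -
    have "(norm (y k))\<^sup>2 \<le> C * (1 / poisson (z k) \<xi>)"
      using y[of k] nonneg_matrix_Re[OF nonneg_matrix_off_point_poisson[OF \<xi> zb], of k "y k"] by simp
    also have "\<dots> \<le> C * (t * cmod (\<xi> - z k))"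
      using inverse_poisson_stolz(1)[OF z t] C by (intro mult_left_mono)
    finally show ?thesis .
  qed
  moreover have "(\<lambda>k. C * (t * cmod (\<xi> - z k))) \<longlonglongrightarrow> C * (t * cmod (\<xi> - \<xi>))"
    by (intro tendsto_intros lim)
  ultimately have "(\<lambda>k. (norm (y k))\<^sup>2) \<longlonglongrightarrow> 0"
    by (intro Lim_null_comparison[of "\<lambda>k. (norm (y k))\<^sup>2"]) auto
  then have "(\<lambda>k. norm (y k)) \<longlonglongrightarrow> 0"
    by (simp add: tendsto_null_power)
  then show ?thesis by (simp add: tendsto_norm_zero_iff)
qed

text \<open>For J = I - f this is the boundary condition that f e tends to e, with e = M w.\<close>

lemma nt_tendsto_resolvent_range:
  "nt_tendsto (\<lambda>z. J z *v (M *v w)) 0 \<xi>"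
proof (rule nt_tendsto_sequentiallyI)
  fix t z assume t: "t > 1" and z: "\<And>k::nat. z k \<in> stolz \<xi> t" and lim: "z \<longlonglongrightarrow> \<xi>"
  have zb: "z k \<in> ball 0 1" for k using z[of k] by (auto simp: stolz_def)
  show "(\<lambda>k. J (z k) *v (M *v w)) \<longlonglongrightarrow> 0"
    by (rule tendsto_zero_if_poisson_bound[OF t z lim resolvent_point_bound[OF zb]
        nonneg_matrix_Re[OF nonneg_matrix_point[OF \<xi>]]])
qed

text \<open>Splitting off the mass at \<open>\<xi>\<close>, \<open>H + I = c M + T\<close> with \<open>c = (\<xi> + z) / (\<xi> - z)\<close>, and
  \<open>J (H + I) = 2 I\<close> yields \<open>c M J M = 2 M - M J T\<close>, where \<open>M J T \<rightarrow> 0\<close>.\<close>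
lemma nt_tendsto_compressed_resolvent:
  "nt_tendsto (\<lambda>z. cscale (1 / (z - \<xi>)) (M ** J z ** M)) (cscale (- cnj \<xi>) M) \<xi>"
proof (intro nt_tendsto_matrixI nt_tendsto_sequentiallyI)
  fix i j t z assume t: "t > 1" and z: "\<And>k::nat. z k \<in> stolz \<xi> t" and lim: "z \<longlonglongrightarrow> \<xi>"
  have zb: "z k \<in> ball 0 1" for k using z[of k] by (auto simp: stolz_def)
  define w where "w = (axis j 1 :: complex ^ 'n)"
  define v where "v = (axis i 1 :: complex ^ 'n)"
  \<comment> \<open>y carries J and the left factor M over to the test vector: <M J a, v> = <a,
    y>.\<close>
  define y where "y = (\<lambda>k. mat_adj (J (z k)) *v (M *v v))"
  define m where "m = (\<lambda>k. cinner ((M ** J (z k) ** M) *v w) v)"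
  note yb = adjoint_resolvent_point_bound[OF zb, of _ v, folded y_def]
  have y0: "y \<longlonglongrightarrow> 0"
    unfolding y_def by (rule tendsto_zero_if_poisson_bound[OF t z lim adjoint_resolvent_point_bound[OF zb]
        nonneg_matrix_Re[OF nonneg_matrix_point[OF \<xi>]]])
  \<comment> \<open>u is the part of T w that does not depend on z.\<close>
  define u where "u = w + cscale \<i> (im_part (H 0)) *v w"
  define r where "r = (\<lambda>k. cinner (matrix_integral \<mu> (off_point \<xi> (herglotz (z k))) *v w) (y k))"
  have r0: "r \<longlonglongrightarrow> 0"
    unfolding r_def using adjoint_resolvent_point_bound[OF zb]
    by (intro tendsto_off_point_herglotz[OF \<xi> t z lim]) (auto simp: y_def)
  have u0: "(\<lambda>k. cinner u (y k)) \<longlonglongrightarrow> 0"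
  proof -
    have "(\<lambda>k. cinner u (y k)) \<longlonglongrightarrow> cinner u 0"
      unfolding cinner_def using y0 by (intro tendsto_intros tendsto_vec_nth)
    then show ?thesis by simp
  qed
  have adj: "cinner a (y k) = cinner ((M ** J (z k)) *v a) v" for a k
    unfolding y_def by (metis M_adj cinner_mat_adj cinner_mat_adj' matrix_vector_mul_assoc)
  have id: "herglotz (z k) \<xi> * m k = 2 * cinner (M *v w) v - cinner u (y k) - r k" for k
  proof -
    have "cinner ((H (z k) + mat 1) *v w) (y k) = cinner ((M ** (J (z k) ** (H (z k) + mat 1))) *v w) v"
      unfolding adj by (simp add: matrix_vector_mul_assoc matrix_mul_assoc)
    also have "\<dots> = 2 * cinner (M *v w) v"
      unfolding JH[OF zb] by (simp add: cscale_mult_right cscale_mult_vec cinner_scale_left)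
    finally have 1: "cinner ((H (z k) + mat 1) *v w) (y k) = 2 * cinner (M *v w) v" .
    have "(H (z k) + mat 1) *v w = u + herglotz (z k) \<xi> *s (M *v w) +
        matrix_integral \<mu> (off_point \<xi> (herglotz (z k))) *v w"
      unfolding herglotz_representation[OF zb] matrix_integral_split_point[OF bounded_borel_herglotz[OF zb] \<xi>]
      by (simp add: u_def matrix_vector_mult_add_rdistrib cscale_mult_vec)
    moreover have "m k = cinner (M *v w) (y k)"
      unfolding adj m_def by (simp add: matrix_vector_mul_assoc)
    ultimately have "cinner ((H (z k) + mat 1) *v w) (y k) = cinner u (y k) + herglotz (z k) \<xi> * m k + r k"
      by (simp add: cinner_add_left cinner_scale_left r_def)
    with 1 show ?thesis by (simp add: algebra_simps)
  qed
  have \<xi>0: "\<xi> \<noteq> 0" "cmod \<xi> = 1" using \<xi> by auto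
  have nz: "\<xi> + z k \<noteq> 0" "z k \<noteq> \<xi>" for k
    using zb[of k] \<xi>0 by (auto simp: add_eq_0_iff)
  \<comment> \<open>Since c = (\<xi> + z) / (\<xi> - z), m / (z - \<xi>) = - c m / (\<xi> + z). The
    denominator tends to 2 \<xi>, and 2 / (2 \<xi>) = cnj \<xi>.\<close>
  have "(\<lambda>k. - (2 * cinner (M *v w) v - cinner u (y k) - r k) / (\<xi> + z k)) \<longlonglongrightarrow>
      - (2 * cinner (M *v w) v - 0 - 0) / (\<xi> + \<xi>)"
    using \<xi>0 by (intro tendsto_intros u0 r0 lim) auto
  moreover have "- (2 * cinner (M *v w) v - cinner u (y k) - r k) / (\<xi> + z k) = 1 / (z k - \<xi>) * m k" for k
    unfolding id[symmetric] herglotz_def using nz[of k] by (simp add: divide_simps) (simp add: algebra_simps)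
  moreover have "- (2 * cinner (M *v w) v - 0 - 0) / (\<xi> + \<xi>) = - cnj \<xi> * cinner (M *v w) v"
    using \<xi>0 by (simp add: complex_div_cnj[of _ \<xi>] mult.commute flip: mult_2)
  ultimately have "(\<lambda>k. 1 / (z k - \<xi>) * m k) \<longlonglongrightarrow> - cnj \<xi> * cinner (M *v w) v"
    by simp
  then show "(\<lambda>k. cscale (1 / (z k - \<xi>)) (M ** J (z k) ** M) $ i $ j) \<longlonglongrightarrow> cscale (- cnj \<xi>) M $ i $ j"
    by (simp add: cscale_def m_def w_def v_def cinner_axis)
qed

end

section \<open>Compression to the range of the atom, and the angular derivative\<close>

lemma nt_tendsto_mult_const:
  fixes F :: "complex \<Rightarrow> complex ^ 'n ^ 'm"
  assumes "nt_tendsto F A \<xi>"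
  shows "nt_tendsto (\<lambda>z. X ** F z ** Y) (X ** A ** Y) \<xi>"
  unfolding nt_tendsto_def
proof (intro allI impI vec_tendstoI)
  fix t :: real and i j assume "t > 1"
  then have F: "(F \<longlongrightarrow> A) (at \<xi> within stolz \<xi> t)"
    using assms by (simp add: nt_tendsto_def)
  show "((\<lambda>z. (X ** F z ** Y) $ i $ j) \<longlongrightarrow> (X ** A ** Y) $ i $ j) (at \<xi> within stolz \<xi> t)"
    unfolding matrix_matrix_mult_nth
    by (intro tendsto_sum tendsto_mult tendsto_const tendsto_vec_nth F)
qed

theorem theorem7p4:
  fixes b :: "complex \<Rightarrow> complex ^ 'n ^ 'n"
    and \<alpha> :: "complex ^ 'n ^ 'n"
    and \<mu> :: "complex set \<Rightarrow> complex ^ 'n ^ 'n"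
    and \<xi> :: complex
    and E :: "(complex ^ 'n) set"
  assumes "b \<in> schur_class"
    and "unitary_matrix \<alpha>"
    and "is_AC_measure b \<alpha> \<mu>"
    and "\<xi> \<in> sphere 0 1"
    and "\<mu> {\<xi>} \<noteq> 0"
    and "E = range ((*v) (\<mu> {\<xi>}))"
  shows "has_CAD_on E (\<lambda>z. b z ** mat_adj \<alpha>) \<xi> \<and>
         moore_penrose_inverse (CAD E (\<lambda>z. b z ** mat_adj \<alpha>) \<xi>) = cscale \<xi> (\<mu> {\<xi>})"
proof -
  define f where "f = (\<lambda>z. b z ** mat_adj \<alpha>)"
  define M where "M = \<mu> {\<xi>}"
  have f: "f \<in> schur_class"
    unfolding f_def by (rule schur_class_mult_unitary[OF assms(1,2)])
  then have hol: "matrix_holomorphic_on f (ball 0 1)"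
    by (simp add: schur_class_def)
  have inv: "invertible (mat 1 - b z ** mat_adj \<alpha>)" if "z \<in> ball 0 1" for z
    using f that by (intro invertible_one_minus_contraction) (auto simp: schur_class_def f_def)
  have \<mu>: "nonneg_matrix_measure \<mu>"
    using assms(3) by (simp add: is_AC_measure_def)
  interpret clark_resolvent \<mu> "AC_function b \<alpha>" "\<lambda>z. mat 1 - f z" \<xi>
  proof
    show "AC_function b \<alpha> z = cscale \<i> (im_part (AC_function b \<alpha> 0)) + matrix_integral \<mu> (herglotz z)"
      if "z \<in> ball 0 1" for z
      using assms(3) that unfolding is_AC_measure_def herglotz_def by blast
  qed (use \<mu> assms(4) AC_function_resolvent[OF inv] in \<open>simp_all only: f_def\<close>)
  have M: "mat_adj M = M" unfolding M_def by (rule M_adj)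
  then obtain X where X: "is_moore_penrose M X" and comm: "M ** X = X ** M"
    by (rule hermitian_moore_penrose)
  have MXM: "M ** X ** M = M" and XMX: "X ** M ** X = X"
    using X by (auto simp: is_moore_penrose_def)
  \<comment> \<open>Since also P = X M, multiplying M (I - f) M by X on both sides produces P (I -
    f) P.\<close>
  define P where "P = M ** X"
  have P': "P = X ** M" using comm by (simp add: P_def)
  have idem: "P ** P = P"
    unfolding P_def by (simp add: matrix_mul_assoc MXM)
  have range_P: "range ((*v) P) = E"
  proof -
    have "P *v x = M *v (X *v x)" "M *v x = P *v (M *v x)" for x
      by (simp_all add: P_def matrix_vector_mul_assoc MXM)
    then show ?thesis unfolding assms(6) M_def[symmetric] by (auto intro: range_eqI)
  qed
  have proj: "orth_proj E = P"
    using orth_proj_eq[OF idem] X unfolding range_P by (simp add: P_def is_moore_penrose_def)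
  define D where "D = cscale (cnj \<xi>) X"
  have limit: "nt_tendsto (\<lambda>z. P ** matrix_deriv f z ** P) D \<xi>"
  proof (rule nt_tendsto_cong)
    \<comment> \<open>Subtracting P leaves the derivative unchanged and makes the function tend to 0
      at \<xi>, so that its quotient by z - \<xi> can converge.\<close>
    show "nt_tendsto (matrix_deriv (\<lambda>z. P ** f z ** P - P)) D \<xi>"
    proof (rule nt_tendsto_matrix_deriv)
      \<comment> \<open>The sign between P f P - P and P (I - f) P is put into the right factor,
        where it meets the sign of the limit - cnj \<xi> M.\<close>
      have "cscale (1 / (z - \<xi>)) (P ** f z ** P - P) =
          X ** cscale (1 / (z - \<xi>)) (M ** (mat 1 - f z) ** M) ** cscale (- 1) X" for z
      proof -
        have "P ** f z ** P - P = cscale (- 1) (P ** (mat 1 - f z) ** P)"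
          by (simp add: matrix_diff_ldistrib matrix_diff_rdistrib idem)
             (simp add: cscale_def vec_eq_iff)
        also have "P ** (mat 1 - f z) ** P = X ** (M ** (mat 1 - f z) ** M) ** X"
          by (subst P', simp add: P_def matrix_mul_assoc)
        finally show ?thesis
          by (simp add: cscale_mult_left cscale_mult_right mult.commute)
      qed
      moreover have "X ** cscale (- cnj \<xi>) M ** cscale (- 1) X = D"
        by (simp add: D_def cscale_mult_left cscale_mult_right XMX)
      ultimately show "nt_tendsto (\<lambda>z. cscale (1 / (z - \<xi>)) (P ** f z ** P - P)) D \<xi>"
        using nt_tendsto_mult_const[OF nt_tendsto_compressed_resolvent, of X "cscale (- 1) X"]
        by (simp add: M_def)
    qed (intro matrix_holomorphic_diff_const matrix_holomorphic_const_mult hol assms(4))+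
    show "matrix_deriv (\<lambda>z. P ** f z ** P - P) z = P ** matrix_deriv f z ** P" if "z \<in> ball 0 1" for z
      by (rule matrix_deriv_affine[OF hol open_ball that])
  qed
  have boundary: "nt_tendsto (\<lambda>z. f z *v e) e \<xi>" if "e \<in> E" for e
  proof -
    obtain w where e: "e = \<mu> {\<xi>} *v w" using \<open>e \<in> E\<close> unfolding assms(6) by (rule rangeE)
    have "f z *v e = e - (mat 1 - f z) *v e" for z
      by (simp add: matrix_vector_mult_diff_rdistrib)
    moreover have "nt_tendsto (\<lambda>z. e - (mat 1 - f z) *v e) (e - 0) \<xi>"
      using nt_tendsto_resolvent_range[of w] unfolding nt_tendsto_def e
      by (intro allI impI tendsto_diff tendsto_const) auto
    ultimately show ?thesis by simp
  qed
  have "vec.subspace E"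
    unfolding assms(6) by (rule vec.subspace_image[OF vec.subspace_UNIV])
  then have "has_CAD_on E f \<xi>"
    unfolding has_CAD_on_def proj using f assms(4) boundary limit by blast
  moreover have "CAD E f \<xi> = D"
    unfolding CAD_def proj by (rule nt_lim_eq[OF assms(4) limit])
  moreover have "moore_penrose_inverse D = cscale \<xi> M"
    unfolding D_def using assms(4)
    by (intro moore_penrose_inverse_eq is_moore_penrose_cscale_sym[OF X])
       (simp add: complex_norm_square[symmetric] mult.commute)
  ultimately show ?thesis
    by (simp add: f_def M_def)
qed

end
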